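(* Let $M$ be an infinite complete metric space. Assume that for every infinite compact $K\subset M$, the space $\mathcal{F}(K)$ is $\ell_1$-saturated. Then $\mathcal{F}(M)$ is $\ell_1$-saturated.
   Context: All metric spaces come with a distinguished base point $0$. $\mathrm{Lip}_0(M)$ is the Banach space of real-valued Lipschitz functions $f$ on $M$ with $f(0)=0$, normed by the best Lipschitz constant. For $x\in M$ let $\delta(x)\in\mathrm{Lip}_0(M)^*$ be $\delta(x)(f)=f(x)$. The Lipschitz-free space is $\mathcal{F}(M)=\overline{\operatorname{span}}\{\delta(x):x\in M\}\subset\mathrm{Lip}_0(M)^*$ (norm closure). For $N\subset M$, $\mathcal{F}(N)$ is identified with the closed subspace $\overline{\operatorname{span}}\{\delta(x):x\in N\}$ of $\mathcal{F}(M)$ (canonically isometric to the free space over $N\cup\{0\}$). A Banach space is $\ell_1$-saturated if each of its infinite-dimensional closed subspaces contains a subspace isomorphic (linearly homeomorphic) to $\ell_1$. *)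

theory Defs
  imports "HOL-Analysis.Analysis"
begin

class pointed_metric_space = metric_space +
  fixes base_point :: 'a

typedef (overloaded) 'a lip0 =
  "{f :: 'a::pointed_metric_space \<Rightarrow> real. f base_point = 0 \<and> (\<exists>L. L-lipschitz_on UNIV f)}"
  morphisms lip0_apply Lip0
  by (rule exI[of _ "\<lambda>_. 0"]) (auto simp: lipschitz_on_def)

setup_lifting type_definition_lip0

lemma lipschitz_on_add_real:
  fixes f g :: "'a::metric_space \<Rightarrow> real"
  assumes "L-lipschitz_on X f" "K-lipschitz_on X g"
  shows "(L + K)-lipschitz_on X (\<lambda>x. f x + g x)"
proof (rule lipschitz_onI)
  fix x y assume "x \<in> X" "y \<in> X"
  then have "\<bar>f x - f y\<bar> \<le> L * dist x y" "\<bar>g x - g y\<bar> \<le> K * dist x y"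
    using assms by (auto simp: lipschitz_on_def dist_real_def)
  then show "dist (f x + g x) (f y + g y) \<le> (L + K) * dist x y"
    by (simp add: dist_real_def distrib_right)
qed (use assms in \<open>auto simp: lipschitz_on_def\<close>)

lemma lipschitz_on_scale_real:
  fixes f :: "'a::metric_space \<Rightarrow> real"
  assumes "L-lipschitz_on X f"
  shows "(\<bar>c\<bar> * L)-lipschitz_on X (\<lambda>x. c * f x)"
proof (rule lipschitz_onI)
  fix x y assume "x \<in> X" "y \<in> X"
  then have "\<bar>f x - f y\<bar> \<le> L * dist x y"
    using assms by (auto simp: lipschitz_on_def dist_real_def)
  then have "\<bar>c\<bar> * \<bar>f x - f y\<bar> \<le> \<bar>c\<bar> * (L * dist x y)"
    by (rule mult_left_mono) simp
  then show "dist (c * f x) (c * f y) \<le> (\<bar>c\<bar> * L) * dist x y"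
    by (simp add: dist_real_def right_diff_distrib[symmetric] abs_mult mult.assoc)
qed (use assms in \<open>auto simp: lipschitz_on_def\<close>)

definition best_lipschitz :: "('a::metric_space \<Rightarrow> real) \<Rightarrow> real" where
  "best_lipschitz f = Inf {L. L-lipschitz_on UNIV f}"

lemma best_lipschitz_le: "L-lipschitz_on UNIV f \<Longrightarrow> best_lipschitz f \<le> L"
  unfolding best_lipschitz_def
  by (rule cInf_lower) (auto intro!: bdd_belowI[of _ 0] simp: lipschitz_on_def)

lemma best_lipschitz_on:
  assumes "\<exists>L. L-lipschitz_on UNIV f"
  shows "(best_lipschitz f)-lipschitz_on UNIV f"
proof (rule lipschitz_onI)
  show "0 \<le> best_lipschitz f"
    unfolding best_lipschitz_def
    by (rule cInf_greatest) (use assms in \<open>auto simp: lipschitz_on_def\<close>)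
  fix x y
  show "dist (f x) (f y) \<le> best_lipschitz f * dist x y"
  proof (cases "x = y")
    case False
    then have "dist (f x) (f y) / dist x y \<le> best_lipschitz f"
      unfolding best_lipschitz_def
      by (intro cInf_greatest)
        (use assms in \<open>auto simp: pos_divide_le_eq dest: lipschitz_onD[of _ _ _ x y]\<close>)
    with False show ?thesis by (simp add: pos_divide_le_eq)
  qed simp
qed

instantiation lip0 :: (pointed_metric_space) real_normed_vector
begin

lift_definition zero_lip0 :: "'a lip0" is "\<lambda>_. 0"
  by (auto simp: lipschitz_on_def)

lift_definition plus_lip0 :: "'a lip0 \<Rightarrow> 'a lip0 \<Rightarrow> 'a lip0" is "\<lambda>f g x. f x + g x"
  by (auto intro: lipschitz_on_add_real)

lift_definition scaleR_lip0 :: "real \<Rightarrow> 'a lip0 \<Rightarrow> 'a lip0" is "\<lambda>c f x. c * f x"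
  by (auto intro: lipschitz_on_scale_real)

lift_definition uminus_lip0 :: "'a lip0 \<Rightarrow> 'a lip0" is "\<lambda>f x. - f x"
  using lipschitz_on_scale_real[where c = "-1"] by fastforce

definition minus_lip0 :: "'a lip0 \<Rightarrow> 'a lip0 \<Rightarrow> 'a lip0" where
  "minus_lip0 f g = f + - g"

lift_definition norm_lip0 :: "'a lip0 \<Rightarrow> real" is best_lipschitz .

definition sgn_lip0 :: "'a lip0 \<Rightarrow> 'a lip0" where
  "sgn_lip0 f = scaleR (inverse (norm f)) f"

definition dist_lip0 :: "'a lip0 \<Rightarrow> 'a lip0 \<Rightarrow> real" where
  "dist_lip0 f g = norm (f - g)"

definition uniformity_lip0 :: "('a lip0 \<times> 'a lip0) filter" where
  "uniformity_lip0 = (INF e\<in>{0<..}. principal {(f, g). dist f g < e})"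

definition open_lip0 :: "'a lip0 set \<Rightarrow> bool" where
  "open_lip0 S = (\<forall>f\<in>S. \<forall>\<^sub>F (f', g) in uniformity. f' = f \<longrightarrow> g \<in> S)"

instance
proof
  fix f g h :: "'a lip0" and a b :: real
  show "f + g + h = f + (g + h)" by transfer (simp add: add.assoc)
  show "f + g = g + f" by transfer (simp add: add.commute)
  show "0 + f = f" by transfer simp
  show "- f + f = 0" by transfer simp
  show "f - g = f + - g" by (rule minus_lip0_def)
  show "a *\<^sub>R (f + g) = a *\<^sub>R f + a *\<^sub>R g" by transfer (simp add: distrib_left)
  show "(a + b) *\<^sub>R f = a *\<^sub>R f + b *\<^sub>R f" by transfer (simp add: distrib_right)
  show "a *\<^sub>R b *\<^sub>R f = (a * b) *\<^sub>R f" by transfer (simp add: mult.assoc)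
  show "1 *\<^sub>R f = f" by transfer simp
  show "sgn f = scaleR (inverse (norm f)) f" by (rule sgn_lip0_def)
  show "dist f g = norm (f - g)" by (rule dist_lip0_def)
  show "uniformity = (INF e\<in>{0<..}. principal {(f::'a lip0, g). dist f g < e})"
    by (rule uniformity_lip0_def)
  show "open U = (\<forall>f\<in>U. \<forall>\<^sub>F (f', g) in uniformity. f' = f \<longrightarrow> g \<in> U)" for U :: "'a lip0 set"
    by (rule open_lip0_def)
  show "(norm f = 0) = (f = 0)"
  proof transfer
    fix f :: "'a \<Rightarrow> real"
    assume f: "f base_point = 0 \<and> (\<exists>L. L-lipschitz_on UNIV f)"
    show "(best_lipschitz f = 0) = (f = (\<lambda>_. 0))"
    proof
      assume "best_lipschitz f = 0"
      with best_lipschitz_on[of f] f have "dist (f x) (f base_point) \<le> 0" for x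
        unfolding lipschitz_on_def by (metis UNIV_I mult_zero_left)
      with f show "f = (\<lambda>_. 0)" by auto
    next
      assume z: "f = (\<lambda>_. 0)"
      then have "0-lipschitz_on UNIV f" by (simp add: lipschitz_on_def)
      then show "best_lipschitz f = 0"
        using best_lipschitz_le[of 0 f] best_lipschitz_on[of f] lipschitz_on_nonneg by fastforce
    qed
  qed
  show "norm (f + g) \<le> norm f + norm g"
    by transfer (auto intro!: best_lipschitz_le lipschitz_on_add_real best_lipschitz_on)
  have le: "norm (c *\<^sub>R k) \<le> \<bar>c\<bar> * norm k" for c and k :: "'a lip0"
    by transfer (auto intro!: best_lipschitz_le lipschitz_on_scale_real best_lipschitz_on)
  show "norm (a *\<^sub>R f) = \<bar>a\<bar> * norm f"
  proof (cases "a = 0")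
    case True
    have "0 \<le> norm (a *\<^sub>R f)"
      by transfer (use best_lipschitz_on lipschitz_on_nonneg lipschitz_on_scale_real in blast)
    then show ?thesis using le[of a f] True by simp
  next
    case False
    have "inverse a *\<^sub>R a *\<^sub>R f = f"
      using False by transfer (simp add: mult.assoc[symmetric])
    then have "norm f \<le> \<bar>inverse a\<bar> * norm (a *\<^sub>R f)"
      using le[of "inverse a" "a *\<^sub>R f"] by simp
    then have "\<bar>a\<bar> * norm f \<le> norm (a *\<^sub>R f)"
      using False by (simp add: abs_inverse field_simps)
    with le[of a f] show ?thesis by simp
  qed
qed

end

lift_definition delta :: "'a::pointed_metric_space \<Rightarrow> 'a lip0 \<Rightarrow>\<^sub>L real" is
  "\<lambda>x f. lip0_apply f x"
proof -
  fix x :: 'a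
  show "bounded_linear (\<lambda>f. lip0_apply f x)"
  proof (rule bounded_linear_intro[where K = "dist x base_point"])
    fix f g :: "'a lip0" and r :: real
    show "lip0_apply (f + g) x = lip0_apply f x + lip0_apply g x"
      by transfer simp
    show "lip0_apply (r *\<^sub>R f) x = r *\<^sub>R lip0_apply f x"
      by transfer simp
    show "norm (lip0_apply f x) \<le> norm f * dist x base_point"
    proof transfer
      fix f :: "'a \<Rightarrow> real" and x
      assume "f base_point = 0 \<and> (\<exists>L. L-lipschitz_on UNIV f)"
      then show "norm (f x) \<le> best_lipschitz f * dist x base_point"
        using lipschitz_onD[OF best_lipschitz_on[of f], of x base_point] by simp
    qed
  qed
qed

lemma delta_base_point [simp]: "delta base_point = 0"
  by (rule blinfun_eqI) (transfer, transfer, simp)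

text \<open>
  The free space over a subset \<open>N\<close> is formed inside the dual of the Lipschitz space of the whole
  ambient type. Since \<open>delta base_point = 0\<close>, it does not matter whether \<open>N\<close> contains the base
  point.
\<close>

definition free_space :: "'a::pointed_metric_space set \<Rightarrow> ('a lip0 \<Rightarrow>\<^sub>L real) set" where
  "free_space N = closure (span (delta ` N))"

typedef ell1 = "{a :: nat \<Rightarrow> real. summable (\<lambda>n. \<bar>a n\<bar>)}"
  morphisms ell1_nth Ell1
  by (rule exI[of _ "\<lambda>_. 0"]) simp

setup_lifting type_definition_ell1

lemma summable_abs_add:
  fixes a b :: "nat \<Rightarrow> real"
  assumes "summable (\<lambda>n. \<bar>a n\<bar>)" "summable (\<lambda>n. \<bar>b n\<bar>)"
  shows "summable (\<lambda>n. \<bar>a n + b n\<bar>)"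
  by (rule summable_comparison_test'[OF summable_add[OF assms], of 0])
    (simp add: abs_triangle_ineq)

instantiation ell1 :: real_normed_vector
begin

lift_definition zero_ell1 :: ell1 is "\<lambda>_. 0" by simp

lift_definition plus_ell1 :: "ell1 \<Rightarrow> ell1 \<Rightarrow> ell1" is "\<lambda>a b n. a n + b n"
  by (rule summable_abs_add)

lift_definition scaleR_ell1 :: "real \<Rightarrow> ell1 \<Rightarrow> ell1" is "\<lambda>c a n. c * a n"
  by (simp add: abs_mult summable_mult)

lift_definition uminus_ell1 :: "ell1 \<Rightarrow> ell1" is "\<lambda>a n. - a n" by simp

definition minus_ell1 :: "ell1 \<Rightarrow> ell1 \<Rightarrow> ell1" where
  "minus_ell1 a b = a + - b"

lift_definition norm_ell1 :: "ell1 \<Rightarrow> real" is "\<lambda>a. \<Sum>n. \<bar>a n\<bar>" .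

definition sgn_ell1 :: "ell1 \<Rightarrow> ell1" where
  "sgn_ell1 a = scaleR (inverse (norm a)) a"

definition dist_ell1 :: "ell1 \<Rightarrow> ell1 \<Rightarrow> real" where
  "dist_ell1 a b = norm (a - b)"

definition uniformity_ell1 :: "(ell1 \<times> ell1) filter" where
  "uniformity_ell1 = (INF e\<in>{0<..}. principal {(a, b). dist a b < e})"

definition open_ell1 :: "ell1 set \<Rightarrow> bool" where
  "open_ell1 S = (\<forall>a\<in>S. \<forall>\<^sub>F (a', b) in uniformity. a' = a \<longrightarrow> b \<in> S)"

instance
proof
  fix a b c :: ell1 and r s :: real
  show "a + b + c = a + (b + c)" by transfer (simp add: add.assoc)
  show "a + b = b + a" by transfer (simp add: add.commute)
  show "0 + a = a" by transfer simp
  show "- a + a = 0" by transfer simp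
  show "a - b = a + - b" by (rule minus_ell1_def)
  show "r *\<^sub>R (a + b) = r *\<^sub>R a + r *\<^sub>R b" by transfer (simp add: distrib_left)
  show "(r + s) *\<^sub>R a = r *\<^sub>R a + s *\<^sub>R a" by transfer (simp add: distrib_right)
  show "r *\<^sub>R s *\<^sub>R a = (r * s) *\<^sub>R a" by transfer (simp add: mult.assoc)
  show "1 *\<^sub>R a = a" by transfer simp
  show "sgn a = scaleR (inverse (norm a)) a" by (rule sgn_ell1_def)
  show "dist a b = norm (a - b)" by (rule dist_ell1_def)
  show "uniformity = (INF e\<in>{0<..}. principal {(a::ell1, b). dist a b < e})"
    by (rule uniformity_ell1_def)
  show "open U = (\<forall>a\<in>U. \<forall>\<^sub>F (a', b) in uniformity. a' = a \<longrightarrow> b \<in> U)" for U :: "ell1 set"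
    by (rule open_ell1_def)
  show "(norm a = 0) = (a = 0)"
    by transfer (auto simp: suminf_eq_zero_iff)
  show "norm (a + b) \<le> norm a + norm b"
    by transfer (auto simp: suminf_add summable_add intro!: suminf_le summable_abs_add)
  show "norm (r *\<^sub>R a) = \<bar>r\<bar> * norm a"
    by transfer (simp add: abs_mult suminf_mult)
qed

end

definition isomorphic_ell1 :: "'v::real_normed_vector set \<Rightarrow> bool" where
  "isomorphic_ell1 Z \<longleftrightarrow> (\<exists>(T :: ell1 \<Rightarrow> 'v) S. linear T \<and> homeomorphism UNIV Z T S)"

text \<open>
  Infinite-dimensional means having no finite spanning set; the library's \<open>dim\<close> is a natural
  number and cannot express this.
\<close>

definition ell1_saturated :: "'v::real_normed_vector set \<Rightarrow> bool" where
  "ell1_saturated X \<longleftrightarrow>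
    (\<forall>Y. subspace Y \<and> closed Y \<and> Y \<subseteq> X \<and> \<not> (\<exists>B. finite B \<and> span B = Y) \<longrightarrow>
      (\<exists>Z. subspace Z \<and> Z \<subseteq> Y \<and> isomorphic_ell1 Z))"

end

theory Submission
  imports Defs
begin

text \<open>
  Let \<open>Y\<close> be an infinite-dimensional closed subspace of \<open>free_space UNIV\<close> containing no copy of
  the space of absolutely summable sequences. Its unit ball is tight: a gliding hump argument,
  which produces such a copy directly, shows that for all positive \<open>d\<close> and \<open>e\<close> there is a finite
  set \<open>E\<close> such that functions of norm one vanishing on a \<open>d\<close>-neighbourhood of \<open>E\<close> are smaller
  than \<open>e\<close> on the unit ball of \<open>Y\<close>. Choosing \<open>e\<close> small compared with \<open>d\<close>, multiplication by a
  cutoff supported near \<open>E\<close> moves \<open>Y\<close> only slightly, and the image of \<open>Y\<close> is again tight.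
  Iterating with \<open>d\<close> tending to zero yields in the limit an isomorphic embedding of \<open>Y\<close> into
  \<open>free_space K\<close> for a compact \<open>K\<close>, where the hypothesis applies.
\<close>

subsection \<open>The Hahn--Banach theorem\<close>

text \<open>A cutoff at scale \<open>d\<close> gives a multiplier whose norm is only bounded by a
  multiple of \<open>1/d\<close>, so the products need not stay bounded as operators. Convergence is
  therefore sought on \<open>Y\<close> alone, where tightness with a tolerance far below
  \<open>d\<close> makes each new factor a small perturbation. Each step needs tightness of the
  image of \<open>Y\<close> under the product \<open>M\<close> built so far. To avoid asking whether
  that image is closed or contains a copy of \<open>ell1\<close>, tightness is formulated on
  \<open>Y\<close> itself, with \<open>\<phi>\<close> tested against \<open>M f\<close>; since
  \<open>M\<close> is bounded, lower estimates for \<phi> composed with \<open>M\<close> give lower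
  estimates for \<phi>, and the forbidden copy appears inside \<open>Y\<close>. In the limit,
  membership in the free space over each of a decreasing sequence of sets must be turned into
  membership in the free space over their intersection. The sets are eventually uniformly close to
  the intersection, and this is what makes the step possible. Separation by functionals enters
  here.\<close>

definition sublinear :: "('v::real_vector \<Rightarrow> real) \<Rightarrow> bool" where
  "sublinear p \<longleftrightarrow> (\<forall>x y. p (x + y) \<le> p x + p y) \<and> (\<forall>c>0. \<forall>x. p (c *\<^sub>R x) \<le> c * p x)"

lemma sublinear_add: "sublinear p \<Longrightarrow> p (x + y) \<le> p x + p y"
  and sublinear_scale_le: "sublinear p \<Longrightarrow> c > 0 \<Longrightarrow> p (c *\<^sub>R x) \<le> c * p x"
  by (auto simp: sublinear_def)

lemma sublinear_zero: "sublinear p \<Longrightarrow> p 0 = 0"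
  using sublinear_add[of p 0 0] sublinear_scale_le[of p "1/2" 0] by simp

text \<open>The inequality for \<open>inverse c\<close> gives the reverse one, so the definition can
  ask for one direction only, which is the one that passes easily to infima.\<close>

lemma sublinear_scale:
  assumes "sublinear p" "c > 0"
  shows "p (c *\<^sub>R x) = c * p x"
proof -
  have "p (inverse c *\<^sub>R c *\<^sub>R x) \<le> inverse c * p (c *\<^sub>R x)"
    using assms by (intro sublinear_scale_le) auto
  then have "c * p x \<le> p (c *\<^sub>R x)"
    using assms(2) by (simp add: field_simps)
  with sublinear_scale_le[OF assms, of x] show ?thesis by simp
qed

lemma sublinear_ge_neg: "sublinear p \<Longrightarrow> - p (- x) \<le> p x"
  using sublinear_add[of p x "- x"] sublinear_zero[of p] by simp

text \<open>Zorn's lemma with pointwise infima of chains. They are finite because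
  \<open>q \<le> p\<close> forces \<open>- p (- x) \<le> - q (- x) \<le> q x\<close>. Passing to a
  minimal functional replaces the extension of functionals one dimension at a time.\<close>

lemma sublinear_minimal_exists:
  fixes p :: "'v::real_vector \<Rightarrow> real"
  assumes p: "sublinear p"
  obtains q where "sublinear q" "q \<le> p" "\<And>r. sublinear r \<Longrightarrow> r \<le> q \<Longrightarrow> r = q"
proof -
  let ?A = "{q. sublinear q \<and> q \<le> p}"
  have "\<exists>m\<in>?A. \<forall>r\<in>?A. r \<le> m \<longrightarrow> r = m"
  proof (rule predicate_Zorn)
    show "partial_order_on ?A (relation_of (\<lambda>q r. r \<le> q) ?A)"
      by (rule partial_order_on_relation_ofI) auto
    fix C assume C: "C \<in> Chains (relation_of (\<lambda>q r. r \<le> q) ?A)"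
    then have CA: "q \<in> C \<Longrightarrow> sublinear q \<and> q \<le> p" for q
      by (auto simp: Chains_def relation_of_def)
    have tot: "q \<in> C \<Longrightarrow> r \<in> C \<Longrightarrow> q \<le> r \<or> r \<le> q" for q r
      using C by (auto simp: Chains_def relation_of_def)
    show "\<exists>u\<in>?A. \<forall>a\<in>C. u \<le> a"
    proof (cases "C = {}")
      case True then show ?thesis using p by auto
    next
      case False
      define u where "u x = (INF q\<in>C. q x)" for x
      have "- p (- x) \<le> q x" if "q \<in> C" for q x
        using CA[OF that] sublinear_ge_neg[of q x] by (auto simp: le_fun_def intro: order_trans[rotated])
      then have bdd: "bdd_below ((\<lambda>q. q x) ` C)" for x
        by (auto intro!: bdd_belowI[of _ "- p (- x)"])
      have ule: "u x \<le> q x" if "q \<in> C" for q x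
        unfolding u_def by (rule cINF_lower[OF bdd that])
      have uge: "b \<le> u x" if "\<And>q. q \<in> C \<Longrightarrow> b \<le> q x" for b x
        unfolding u_def using False that by (rule cINF_greatest)
      have "u (x + y) \<le> u x + u y" for x y
      proof -
        have *: "u (x + y) \<le> q x + r y" if qr: "q \<in> C" "r \<in> C" for q r
        proof -
          \<comment> \<open>Totality of the chain supplies one member below both \<open>q\<close>
            and \<open>r\<close>, whose own subadditivity then applies.\<close>
          obtain s where s: "s \<in> C" "s \<le> q" "s \<le> r" using tot[OF qr] qr by auto
          have "u (x + y) \<le> s x + s y"
            using ule[OF s(1), of "x + y"] CA[OF s(1)] sublinear_add[of s x y] by linarith
          also have "\<dots> \<le> q x + r y" using s by (auto simp: le_fun_def intro: add_mono)
          finally show ?thesis .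
        qed
        have "u (x + y) - q x \<le> u y" if "q \<in> C" for q
          by (rule uge) (use *[OF that] in \<open>auto simp: algebra_simps\<close>)
        then have "u (x + y) - u y \<le> u x" by (intro uge) (auto simp: algebra_simps)
        then show ?thesis by simp
      qed
      moreover have "u (c *\<^sub>R x) \<le> c * u x" if c: "c > 0" for c x
      proof -
        have "u (c *\<^sub>R x) / c \<le> u x"
        proof (rule uge)
          fix q assume q: "q \<in> C"
          have "u (c *\<^sub>R x) \<le> c * q x"
            using ule[OF q, of "c *\<^sub>R x"] CA[OF q] sublinear_scale_le[of q c x] c by linarith
          then show "u (c *\<^sub>R x) / c \<le> q x" using c by (simp add: field_simps)
        qed
        then show ?thesis using c by (simp add: field_simps)
      qed
      ultimately have "sublinear u" by (auto simp: sublinear_def)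
      moreover obtain q where "q \<in> C" using False by auto
      then have "u \<le> p" using ule CA by (metis le_funI order_trans)
      ultimately show ?thesis using ule by (intro bexI[of _ u]) (auto simp: le_fun_def)
    qed
  qed
  then show ?thesis using that by (metis (mono_tags, lifting) mem_Collect_eq order_trans)
qed

text \<open>Applied to a minimal \<open>q\<close>, this forces \<open>q\<close> to be odd, hence linear.\<close>

lemma sublinear_reduce:
  fixes q :: "'v::real_vector \<Rightarrow> real"
  assumes q: "sublinear q"
  obtains r where "sublinear r" "r \<le> q" "r (- y) \<le> - q y"
proof -
  \<comment> \<open>A sublinear \<open>s \<le> q\<close> with \<open>s (- y) \<le> - q y\<close>
    satisfies \<open>s x \<le> s (x + t *\<^sub>R y) + t * s (- y)\<close> for
    \<open>t \<ge> 0\<close>, so this infimum is the largest candidate. Taking \<open>t = 1\<close>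
    at \<open>- y\<close> yields the required value.\<close>
  define r where "r x = (INF t\<in>{0..}. q (x + t *\<^sub>R y) - t * q y)" for x
  have low: "- q (- x) \<le> q (x + t *\<^sub>R y) - t * q y" if "0 \<le> t" for t x
  proof -
    have "q (t *\<^sub>R y) = t * q y"
      using sublinear_scale[OF q, of t] sublinear_zero[OF q] that by (cases "t = 0") auto
    moreover have "q ((x + t *\<^sub>R y) + (- x)) \<le> q (x + t *\<^sub>R y) + q (- x)"
      by (rule sublinear_add[OF q])
    ultimately show ?thesis by simp
  qed
  have rle: "r x \<le> q (x + t *\<^sub>R y) - t * q y" if "0 \<le> t" for t x
    unfolding r_def using low that by (intro cINF_lower bdd_belowI[of _ "- q (- x)"]) auto
  have rge: "b \<le> r x" if "\<And>t. 0 \<le> t \<Longrightarrow> b \<le> q (x + t *\<^sub>R y) - t * q y" for b x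
    unfolding r_def by (rule cINF_greatest) (use that in auto)
  have "r (x + z) \<le> r x + r z" for x z
  proof -
    have *: "r (x + z) \<le> (q (x + t *\<^sub>R y) - t * q y) + (q (z + s *\<^sub>R y) - s * q y)"
      if "0 \<le> t" "0 \<le> s" for s t
    proof -
      have "r (x + z) \<le> q ((x + z) + (t + s) *\<^sub>R y) - (t + s) * q y" using that by (intro rle) auto
      also have "(x + z) + (t + s) *\<^sub>R y = (x + t *\<^sub>R y) + (z + s *\<^sub>R y)"
        by (simp add: algebra_simps)
      finally show ?thesis
        using sublinear_add[OF q, of "x + t *\<^sub>R y" "z + s *\<^sub>R y"] by (simp add: algebra_simps)
    qed
    have "r (x + z) - (q (x + t *\<^sub>R y) - t * q y) \<le> r z" if "0 \<le> t" for t
      by (rule rge) (use *[OF that] in \<open>auto simp: algebra_simps\<close>)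
    then have "r (x + z) - r z \<le> r x" by (intro rge) (auto simp: algebra_simps)
    then show ?thesis by simp
  qed
  moreover have "r (c *\<^sub>R x) \<le> c * r x" if c: "c > 0" for c x
  proof -
    have "r (c *\<^sub>R x) / c \<le> r x"
    proof (rule rge)
      fix t :: real assume t: "0 \<le> t"
      have "r (c *\<^sub>R x) \<le> q (c *\<^sub>R x + (c * t) *\<^sub>R y) - (c * t) * q y" using c t by (intro rle) auto
      also have "c *\<^sub>R x + (c * t) *\<^sub>R y = c *\<^sub>R (x + t *\<^sub>R y)" by (simp add: algebra_simps)
      also have "q \<dots> - (c * t) * q y = c * (q (x + t *\<^sub>R y) - t * q y)"
        by (simp add: sublinear_scale[OF q c] right_diff_distrib)
      finally show "r (c *\<^sub>R x) / c \<le> q (x + t *\<^sub>R y) - t * q y" using c by (simp add: field_simps)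
    qed
    then show ?thesis using c by (simp add: field_simps)
  qed
  ultimately have "sublinear r" by (auto simp: sublinear_def)
  moreover have "r \<le> q" using rle[of 0] by (auto simp: le_fun_def)
  moreover have "r (- y) \<le> - q y" using rle[of 1 "- y"] sublinear_zero[OF q] by simp
  ultimately show ?thesis using that by blast
qed

lemma sublinear_minimal_linear:
  fixes q :: "'v::real_vector \<Rightarrow> real"
  assumes q: "sublinear q" and min: "\<And>r. sublinear r \<Longrightarrow> r \<le> q \<Longrightarrow> r = q"
  shows "linear q"
proof -
  have neg: "q (- y) = - q y" for y
  proof -
    obtain r where "sublinear r" "r \<le> q" "r (- y) \<le> - q y" using sublinear_reduce[OF q] by blast
    with min[of r] have "q (- y) \<le> - q y" by auto
    with sublinear_ge_neg[OF q, of y] show ?thesis by simp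
  qed
  have add: "q (x + y) = q x + q y" for x y
    using sublinear_add[OF q, of x y] sublinear_add[OF q, of "- x" "- y"] neg[of x] neg[of y]
      neg[of "x + y"] by simp
  have "q (c *\<^sub>R x) = c * q x" for c x
  proof (cases c "0::real" rule: linorder_cases)
    case less
    then have "q ((- c) *\<^sub>R x) = (- c) * q x" by (intro sublinear_scale[OF q]) simp
    with neg[of "c *\<^sub>R x"] show ?thesis by simp
  qed (auto simp: sublinear_scale[OF q] sublinear_zero[OF q])
  with add show ?thesis by (intro linearI) auto
qed

text \<open>The distance to \<open>X\<close> is the majorant for separation: it lies below the norm
  and vanishes on \<open>X\<close>, and a linear functional below it inherits both
  properties.\<close>

lemma infdist_subspace_sublinear:
  fixes X :: "'v::real_normed_vector set"
  assumes X: "subspace X"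
  shows "sublinear (\<lambda>v. infdist v X)"
proof -
  have ne: "X \<noteq> {}" using subspace_0[OF X] by auto
  have ge: "b \<le> infdist x X" if "\<And>a. a \<in> X \<Longrightarrow> b \<le> dist x a" for b x
    unfolding infdist_notempty[OF ne] by (rule cINF_greatest[OF ne]) (use that in auto)
  have "infdist (x + y) X \<le> infdist x X + infdist y X" for x y
  proof -
    have *: "infdist (x + y) X \<le> dist x a + dist y b" if "a \<in> X" "b \<in> X" for a b
      using infdist_le[OF subspace_add[OF X that], of "x + y"] dist_triangle_add[of x y a b] by linarith
    have "infdist (x + y) X - dist x a \<le> infdist y X" if "a \<in> X" for a
      by (rule ge) (use *[OF that] in \<open>auto simp: algebra_simps\<close>)
    then have "infdist (x + y) X - infdist y X \<le> infdist x X" by (intro ge) (auto simp: algebra_simps)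
    then show ?thesis by simp
  qed
  moreover have "infdist (c *\<^sub>R x) X \<le> c * infdist x X" if c: "c > 0" for c x
  proof -
    have "infdist (c *\<^sub>R x) X / c \<le> infdist x X"
    proof (rule ge)
      fix a assume "a \<in> X"
      then have "infdist (c *\<^sub>R x) X \<le> dist (c *\<^sub>R x) (c *\<^sub>R a)"
        by (intro infdist_le subspace_scale[OF X])
      also have "\<dots> = c * dist x a" using c by (simp add: dist_norm flip: scaleR_diff_right)
      finally show "infdist (c *\<^sub>R x) X / c \<le> dist x a" using c by (simp add: field_simps)
    qed
    then show ?thesis using c by (simp add: field_simps)
  qed
  ultimately show ?thesis by (auto simp: sublinear_def)
qed

text \<open>The majorant is first reduced in the direction \<open>y\<close>; every linear functional
  below the reduced one is at most \<open>- infdist y X < 0\<close> at \<open>- y\<close>. A minimal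
  sublinear functional below it is linear, so nothing has to be extended from a subspace.\<close>

lemma Hahn_Banach_separation:
  fixes X :: "'v::real_normed_vector set"
  assumes X: "subspace X" and y: "y \<notin> closure X"
  obtains \<phi> :: "'v \<Rightarrow> real" where "linear \<phi>" "\<And>v. \<bar>\<phi> v\<bar> \<le> norm v" "\<And>v. v \<in> X \<Longrightarrow> \<phi> v = 0"
    "\<phi> y \<noteq> 0"
proof -
  let ?p = "\<lambda>v. infdist v X"
  have ne: "X \<noteq> {}" using subspace_0[OF X] by auto
  have "0 < ?p y"
    using y in_closure_iff_infdist_zero[OF ne, of y] infdist_nonneg[of y X] by linarith
  obtain r where r: "sublinear r" "r \<le> ?p" "r (- y) \<le> - ?p y"
    using sublinear_reduce[OF infdist_subspace_sublinear[OF X]] by blast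
  obtain \<phi> where \<phi>: "sublinear \<phi>" "\<phi> \<le> r" "\<And>s. sublinear s \<Longrightarrow> s \<le> \<phi> \<Longrightarrow> s = \<phi>"
    using sublinear_minimal_exists[OF r(1)] by blast
  then have lin: "linear \<phi>" by (blast intro: sublinear_minimal_linear)
  have le: "\<phi> v \<le> ?p v" for v using \<phi>(2) r(2) by (auto simp: le_fun_def intro: order_trans)
  have abs: "\<bar>\<phi> v\<bar> \<le> max (?p v) (?p (- v))" for v
    using le[of v] le[of "- v"] linear_neg[OF lin, of v] by auto
  have pn: "?p v \<le> norm v" for v using infdist_le[OF subspace_0[OF X], of v] by simp
  have "\<bar>\<phi> v\<bar> \<le> norm v" for v using abs[of v] pn[of v] pn[of "- v"] by auto
  moreover have "\<phi> v = 0" if "v \<in> X" for v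
    using abs[of v] that subspace_neg[OF X that] by simp
  moreover have "\<phi> (- y) \<le> - ?p y" using \<phi>(2) r(3) by (meson le_fun_def order_trans)
  then have "\<phi> y \<noteq> 0" using \<open>0 < ?p y\<close> linear_neg[OF lin, of y] by auto
  ultimately show ?thesis using that lin by blast
qed

text \<open>A functional vanishing on \<open>span B\<close> but not at \<open>b\<close> reads off
  the coefficient of \<open>b\<close> continuously, so the enlarged span is the preimage of
  \<open>span B\<close> under a continuous map.\<close>

lemma closed_span_finite:
  fixes B :: "'v::real_normed_vector set"
  assumes "finite B"
  shows "closed (span B)"
  using assms
proof induction
  case (insert b B)
  show ?case
  proof (cases "b \<in> span B")
    case True
    then show ?thesis using insert.IH by (simp add: span_redundant)
  next
    case False
    then obtain \<phi> :: "'v \<Rightarrow> real" where \<phi>: "linear \<phi>" "\<And>v. \<bar>\<phi> v\<bar> \<le> norm v"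
        "\<And>v. v \<in> span B \<Longrightarrow> \<phi> v = 0" "\<phi> b \<noteq> 0"
      using Hahn_Banach_separation[of "span B" b] insert.IH by (auto simp: closure_closed)
    have "bounded_linear \<phi>"
      using \<phi>(1,2) by (auto simp: bounded_linear_def bounded_linear_axioms_def intro!: exI[of _ 1])
    then have "closed ((\<lambda>v. v - (\<phi> v / \<phi> b) *\<^sub>R b) -` span B)"
      using insert.IH \<phi>(4)
      by (intro closed_vimage continuous_intros bounded_linear.continuous_on[of \<phi>]) auto
    moreover have "(\<lambda>v. v - (\<phi> v / \<phi> b) *\<^sub>R b) -` span B = span (insert b B)"
    proof -
      have "k = \<phi> v / \<phi> b" if "v - k *\<^sub>R b \<in> span B" for v k
        using \<phi>(3)[OF that] \<phi>(4) by (simp add: linear_diff[OF \<phi>(1)] linear_scale[OF \<phi>(1)] field_simps)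
      then show ?thesis by (auto simp: span_insert)
    qed
    ultimately show ?thesis by simp
  qed
qed simp

lemma subspace_closure:
  fixes X :: "'v::real_normed_vector set"
  assumes "subspace X"
  shows "subspace (closure X)"
  unfolding subspace_def
proof (intro conjI ballI allI)
  show "0 \<in> closure X" using subspace_0[OF assms] closure_subset by auto
  fix x y c assume "x \<in> closure X" "y \<in> closure X"
  then obtain f g where "\<And>n. f n \<in> X" "f \<longlonglongrightarrow> x" "\<And>n. g n \<in> X" "g \<longlonglongrightarrow> y"
    unfolding closure_sequential by blast
  then have "\<And>n. f n + g n \<in> X" "(\<lambda>n. f n + g n) \<longlonglongrightarrow> x + y"
      "\<And>n. c *\<^sub>R f n \<in> X" "(\<lambda>n. c *\<^sub>R f n) \<longlonglongrightarrow> c *\<^sub>R x"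
    by (auto intro: tendsto_intros subspace_add[OF assms] subspace_scale[OF assms])
  then show "x + y \<in> closure X" "c *\<^sub>R x \<in> closure X"
    unfolding closure_sequential by meson+
qed

subsection \<open>Sequences equivalent to the unit vector basis\<close>

text \<open>Split \<open>A\<close> into infinitely many infinite pieces. If none of them works, pick a bad index
  in each piece: passing to these indices lowers the bound on the row sums by \<open>e\<close>.\<close>

lemma Rosenthal_disjointification:
  fixes a :: "nat \<Rightarrow> nat \<Rightarrow> real" and A :: "nat set"
  assumes "\<And>j n. 0 \<le> a j n" "0 < e" "infinite A"
    and "\<And>j F. j \<in> A \<Longrightarrow> finite F \<Longrightarrow> F \<subseteq> A \<Longrightarrow> j \<notin> F \<Longrightarrow> sum (a j) F \<le> real k * e"
  obtains N where "N \<subseteq> A" "infinite N"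
    "\<And>j F. j \<in> N \<Longrightarrow> finite F \<Longrightarrow> F \<subseteq> N \<Longrightarrow> j \<notin> F \<Longrightarrow> sum (a j) F \<le> e"
  using assms(3,4)
proof (induction k arbitrary: A thesis)
  case 0
  show ?case by (rule 0(1)[of A]) (use 0(2,3) assms(2) in force)+
next
  case (Suc k)
  define P where "P i = (\<lambda>m. enumerate A (prod_encode (i, m))) ` UNIV" for i
  have PA: "P i \<subseteq> A" for i unfolding P_def using enumerate_in_set[OF Suc.prems(2)] by auto
  have inj: "enumerate A m = enumerate A n \<longleftrightarrow> m = n" for m n
    using inj_enumerate[OF Suc.prems(2)] by (simp add: inj_eq)
  have Pinf: "infinite (P i)" for i
    unfolding P_def by (rule range_inj_infinite) (auto simp: inj_def inj)
  have Pdisj: "i = i'" if "n \<in> P i" "n \<in> P i'" for i i' n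
    using that by (auto simp: P_def inj)
  show ?case
  proof (cases "\<exists>i. \<forall>j\<in>P i. \<forall>F. finite F \<longrightarrow> F \<subseteq> P i \<longrightarrow> j \<notin> F \<longrightarrow> sum (a j) F \<le> e")
    case True
    then obtain i where "\<forall>j\<in>P i. \<forall>F. finite F \<longrightarrow> F \<subseteq> P i \<longrightarrow> j \<notin> F \<longrightarrow> sum (a j) F \<le> e"
      by blast
    then show ?thesis by (intro Suc.prems(1)[OF PA[of i] Pinf[of i]]) auto
  next
    case False
    then have "\<forall>i. \<exists>j F. j \<in> P i \<and> finite F \<and> F \<subseteq> P i \<and> j \<notin> F \<and> e < sum (a j) F"
      by (meson not_le)
    then obtain J G where JG: "\<And>i. J i \<in> P i" "\<And>i. finite (G i)" "\<And>i. G i \<subseteq> P i"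
        "\<And>i. J i \<notin> G i" "\<And>i. e < sum (a (J i)) (G i)"
      by metis
    have "inj J" using Pdisj JG(1) by (metis injI)
    then have inf: "infinite (range J)" by (rule range_inj_infinite)
    have bnd: "sum (a j) F \<le> real k * e"
      if jF: "j \<in> range J" "finite F" "F \<subseteq> range J" "j \<notin> F" for j F
    proof -
      obtain i where i: "j = J i" using jF by auto
      \<comment> \<open>Since \<open>j = J i\<close> is not in \<open>F\<close>, the points of
        \<open>F\<close> come from pieces other than \<open>P i\<close>, which contains
        \<open>G i\<close>. Joining \<open>G i\<close> to \<open>F\<close> thus uses up more than
        \<open>e\<close> of the allowed \<open>(k + 1) * e\<close>.\<close>
      have disj: "F \<inter> G i = {}"
      proof (rule ccontr)
        assume "F \<inter> G i \<noteq> {}"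
        then obtain n where "n \<in> F" "n \<in> G i" by auto
        then obtain i' where n: "n \<in> F" "n \<in> G i" "n = J i'" using jF by auto
        then have "i' = i" using Pdisj[of n i' i] JG by auto
        with n i jF show False by auto
      qed
      have "sum (a j) (F \<union> G i) \<le> real (Suc k) * e"
      proof (rule Suc.prems(3))
        show "j \<in> A" using i JG(1) PA by auto
        show "F \<union> G i \<subseteq> A" using jF(3) JG(1)[THEN subsetD[OF PA]] JG(3)[of i] PA[of i] by auto
      qed (use i jF JG in auto)
      moreover have "sum (a j) (F \<union> G i) = sum (a j) F + sum (a j) (G i)"
        using jF JG disj by (intro sum.union_disjoint) auto
      ultimately show ?thesis using JG(5)[of i] i by (simp add: algebra_simps)
    qed
    show ?thesis
    proof (rule Suc.IH[OF _ inf bnd])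
      fix N assume N: "N \<subseteq> range J" "infinite N"
        "\<And>j F. j \<in> N \<Longrightarrow> finite F \<Longrightarrow> F \<subseteq> N \<Longrightarrow> j \<notin> F \<Longrightarrow> sum (a j) F \<le> e"
      have "range J \<subseteq> A" using JG(1) PA by auto
      with N show thesis by (intro Suc.prems(1)[of N]) auto
    qed auto
  qed
qed

lemma isomorphic_ell1_range:
  fixes T :: "ell1 \<Rightarrow> 'v::real_normed_vector"
  assumes "bounded_linear T" "c > 0" and low: "\<And>a. c * norm a \<le> norm (T a)"
  shows "isomorphic_ell1 (range T)"
proof -
  interpret T: bounded_linear T by fact
  have dist: "c * dist a b \<le> dist (T a) (T b)" for a b
    using low[of "a - b"] by (simp add: dist_norm T.diff)
  have inj: "inj T"
  proof (rule injI)
    fix a b assume "T a = T b"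
    with dist[of a b] assms(2) show "a = b" by (simp add: mult_le_0_iff)
  qed
  have "(1 / c)-lipschitz_on (range T) (inv T)"
  proof (rule lipschitz_onI)
    fix u v assume "u \<in> range T" "v \<in> range T"
    then obtain a b where "u = T a" "v = T b" by auto
    with dist[of a b] inj assms(2) show "dist (inv T u) (inv T v) \<le> 1 / c * dist u v"
      by (simp add: field_simps)
  qed (use assms in auto)
  then have "homeomorphism UNIV (range T) T (inv T)"
    using inj by (intro homeomorphismI) (auto intro: lipschitz_on_continuous_on T.continuous_on continuous_on_id)
  then show ?thesis unfolding isomorphic_ell1_def using T.linear_axioms by blast
qed

lemma isomorphic_ell1_image:
  assumes "isomorphic_ell1 Z" "linear G" "homeomorphism Z W G H"
  shows "isomorphic_ell1 W"
  using assms unfolding isomorphic_ell1_def by (metis homeomorphism_compose linear_compose)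

text \<open>The upper estimate is free from \<open>norm (x n) \<le> 1\<close>: absolutely summable
  coefficients give convergent series. The lower estimate passes from finite sums to the
  limit.\<close>

lemma ell1_basic_sequence_subspace:
  fixes x :: "nat \<Rightarrow> 'v::banach"
  assumes Y: "subspace Y" "closed Y" and x: "\<And>n. x n \<in> Y" "\<And>n. norm (x n) \<le> 1"
    and c: "c > 0" and low: "\<And>F a. finite F \<Longrightarrow> c * (\<Sum>n\<in>F. \<bar>a n\<bar>) \<le> norm (\<Sum>n\<in>F. a n *\<^sub>R x n)"
  shows "\<exists>Z. subspace Z \<and> Z \<subseteq> Y \<and> isomorphic_ell1 Z"
proof -
  define T where "T a = (\<Sum>n. ell1_nth a n *\<^sub>R x n)" for a
  have sab: "summable (\<lambda>n. \<bar>ell1_nth a n\<bar>)" for a using ell1_nth[of a] by simp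
  have nle: "norm (ell1_nth a n *\<^sub>R x n) \<le> \<bar>ell1_nth a n\<bar>" for a n
    using mult_left_mono[OF x(2)[of n], of "\<bar>ell1_nth a n\<bar>"] by simp
  have sn: "summable (\<lambda>n. norm (ell1_nth a n *\<^sub>R x n))" for a
    by (rule summable_comparison_test'[OF sab[of a], of 0]) (use nle in auto)
  then have s: "summable (\<lambda>n. ell1_nth a n *\<^sub>R x n)" for a by (rule summable_norm_cancel)
  have T: "bounded_linear T"
  proof (rule bounded_linear_intro[where K = 1])
    show "T (a + b) = T a + T b" for a b
      unfolding T_def by (subst suminf_add[OF s s]) (simp add: plus_ell1.rep_eq scaleR_add_left)
    show "T (r *\<^sub>R a) = r *\<^sub>R T a" for r a
      unfolding T_def by (subst suminf_scaleR_right[OF s]) (simp add: scaleR_ell1.rep_eq)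
    show "norm (T a) \<le> norm a * 1" for a
    proof -
      have "norm (T a) \<le> (\<Sum>n. norm (ell1_nth a n *\<^sub>R x n))"
        unfolding T_def by (rule summable_norm[OF sn])
      also have "\<dots> \<le> (\<Sum>n. \<bar>ell1_nth a n\<bar>)" by (rule suminf_le[OF nle sn sab])
      finally show ?thesis by (simp add: norm_ell1.rep_eq)
    qed
  qed
  have "c * norm a \<le> norm (T a)" for a
  proof (rule LIMSEQ_le)
    show "(\<lambda>k. c * (\<Sum>n<k. \<bar>ell1_nth a n\<bar>)) \<longlonglongrightarrow> c * norm a"
      unfolding norm_ell1.rep_eq by (intro tendsto_intros summable_LIMSEQ sab)
    show "(\<lambda>k. norm (\<Sum>n<k. ell1_nth a n *\<^sub>R x n)) \<longlonglongrightarrow> norm (T a)"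
      unfolding T_def by (intro tendsto_intros summable_LIMSEQ s)
  qed (use low in auto)
  then have "isomorphic_ell1 (range T)" using T c by (rule isomorphic_ell1_range[rotated 2])
  moreover have "subspace (range T)"
    using T by (intro linear_subspace_image subspace_UNIV) (simp add: bounded_linear.linear)
  moreover have "T a \<in> Y" for a
  proof (rule closed_sequentially[OF Y(2)])
    show "(\<lambda>k. \<Sum>n<k. ell1_nth a n *\<^sub>R x n) \<longlonglongrightarrow> T a"
      unfolding T_def by (rule summable_LIMSEQ[OF s])
    show "(\<Sum>n<k. ell1_nth a n *\<^sub>R x n) \<in> Y" for k
      by (intro subspace_sum[OF Y(1)] subspace_scale[OF Y(1)] x)
  qed
  ultimately show ?thesis by blast
qed

subsection \<open>Lipschitz functions and the free space\<close>

lemma lip0_apply_simps [simp]: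
  "lip0_apply 0 x = 0" "lip0_apply (f + g) x = lip0_apply f x + lip0_apply g x"
  "lip0_apply (c *\<^sub>R f) x = c * lip0_apply f x" "lip0_apply (- f) x = - lip0_apply f x"
  "lip0_apply (f - g) x = lip0_apply f x - lip0_apply g x"
  by (simp_all only: zero_lip0.rep_eq plus_lip0.rep_eq scaleR_lip0.rep_eq uminus_lip0.rep_eq
      minus_lip0_def diff_conv_add_uminus)

lemma lip0_apply_sum: "lip0_apply (\<Sum>i\<in>I. f i) x = (\<Sum>i\<in>I. lip0_apply (f i) x)"
  by (induction I rule: infinite_finite_induct) auto

lemma lip0_apply_base_point [simp]: "lip0_apply f base_point = 0"
  using lip0_apply[of f] by auto

lemma lip0_lipschitz: "\<bar>lip0_apply f x - lip0_apply f y\<bar> \<le> norm f * dist x y"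
proof -
  have "(norm f)-lipschitz_on UNIV (lip0_apply f)"
    unfolding norm_lip0.rep_eq by (rule best_lipschitz_on) (use lip0_apply[of f] in auto)
  then show ?thesis by (auto simp: lipschitz_on_def dist_real_def)
qed

lemma abs_lip0_apply_le: "\<bar>lip0_apply f x\<bar> \<le> norm f * dist x base_point"
  using lip0_lipschitz[of f x base_point] by simp

lemma norm_lip0_le:
  assumes "\<And>x y. \<bar>lip0_apply f x - lip0_apply f y\<bar> \<le> L * dist x y" "0 \<le> L"
  shows "norm f \<le> L"
  unfolding norm_lip0.rep_eq
  by (rule best_lipschitz_le) (use assms in \<open>auto simp: lipschitz_on_def dist_real_def\<close>)

lemma lip0_eqI: "(\<And>x. lip0_apply f x = lip0_apply g x) \<Longrightarrow> f = g"
  by (simp add: fun_eq_iff flip: lip0_apply_inject)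

lemma lip0_exists:
  assumes "h base_point = 0" "\<And>x y. \<bar>h x - h y\<bar> \<le> L * dist x y" "0 \<le> L"
  obtains f where "\<And>x. lip0_apply f x = h x" "norm f \<le> L"
proof -
  have "L-lipschitz_on UNIV h" using assms by (auto simp: lipschitz_on_def dist_real_def)
  then have eq: "lip0_apply (Lip0 h) = h" using assms(1) by (intro Lip0_inverse) auto
  show ?thesis by (rule that[of "Lip0 h"]) (use assms in \<open>auto simp: eq intro!: norm_lip0_le\<close>)
qed

lemma blinfun_apply_delta [simp]: "blinfun_apply (delta x) f = lip0_apply f x"
  by (simp add: delta.rep_eq)

lemma norm_delta_diff_le: "norm (delta x - delta y) \<le> dist x y"
  by (rule norm_blinfun_bound) (use lip0_lipschitz in \<open>auto simp: blinfun.diff_left mult.commute\<close>)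

lemma subspace_free_space: "subspace (free_space N)"
  and closed_free_space: "closed (free_space N)"
  unfolding free_space_def by (auto intro: subspace_closure)

lemma delta_in_free_space: "x \<in> N \<Longrightarrow> delta x \<in> free_space N"
  unfolding free_space_def by (meson closure_subset imageI span_base subsetD)

lemma free_space_subset:
  assumes "subspace S" "closed S" "\<And>x. x \<in> N \<Longrightarrow> delta x \<in> S"
  shows "free_space N \<subseteq> S"
  unfolding free_space_def using assms by (intro closure_minimal span_minimal) auto

lemma free_space_mono: "N \<subseteq> N' \<Longrightarrow> free_space N \<subseteq> free_space N'"
  by (rule free_space_subset[OF subspace_free_space closed_free_space]) (auto intro: delta_in_free_space)

lemma free_space_image:
  assumes T: "bounded_linear T" and "\<And>x. x \<in> N \<Longrightarrow> T (delta x) \<in> free_space N'"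
    and "\<phi> \<in> free_space N"
  shows "T \<phi> \<in> free_space N'"
proof -
  interpret T: bounded_linear T by fact
  have "free_space N \<subseteq> T -` free_space N'"
  proof (rule free_space_subset)
    show "closed (T -` free_space N')"
      by (intro closed_vimage closed_free_space T.continuous_on continuous_on_id)
    show "subspace (T -` free_space N')"
      by (rule linear_subspace_vimage[OF T.linear_axioms subspace_free_space])
  qed (use assms(2) in auto)
  then show ?thesis using assms(3) by auto
qed

lemma free_space_apply_cong:
  assumes \<phi>: "\<phi> \<in> free_space N" and fg: "\<And>x. x \<in> N \<Longrightarrow> lip0_apply f x = lip0_apply g x"
  shows "blinfun_apply \<phi> f = blinfun_apply \<phi> g"
proof -
  have "free_space N \<subseteq> {\<phi>. blinfun_apply \<phi> f = blinfun_apply \<phi> g}"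
    by (rule free_space_subset)
      (auto simp: subspace_def blinfun.bilinear_simps fg intro!: closed_Collect_eq continuous_intros)
  with \<phi> show ?thesis by auto
qed

lemma span_delta_finite_support:
  assumes "u \<in> span (range delta)"
  obtains F where "finite F" "u \<in> span (delta ` F)"
proof -
  obtain t r where t: "finite t" "t \<subseteq> range delta" "u = (\<Sum>a\<in>t. r a *\<^sub>R a)"
    using assms unfolding span_explicit by blast
  then obtain F where F: "finite F" "t = delta ` F" by (meson finite_subset_image)
  then have "u \<in> span (delta ` F)" unfolding t(3) by (intro span_sum span_scale span_base) auto
  with F that show ?thesis by blast
qed

lemma free_space_approx:
  assumes "\<phi> \<in> free_space UNIV" "e > 0"
  obtains u F where "finite F" "u \<in> span (delta ` F)" "norm (\<phi> - u) < e"
proof -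
  obtain u where "u \<in> span (range delta)" "dist u \<phi> < e"
    using assms unfolding free_space_def closure_approachable by blast
  then show ?thesis using that span_delta_finite_support[of u] by (metis dist_norm dist_commute)
qed

text \<open>On combinations of finitely many evaluations pointwise convergence suffices; the uniform
  norm bound carries this over to their limits. On bounded sets pointwise convergence is weak-star
  convergence.\<close>

lemma free_space_apply_tendsto_zero:
  assumes \<phi>: "\<phi> \<in> free_space UNIV" and g: "\<And>n. norm (g n) \<le> 1"
    "\<And>x. (\<lambda>n. lip0_apply (g n) x) \<longlonglongrightarrow> 0"
  shows "(\<lambda>n. blinfun_apply \<phi> (g n)) \<longlonglongrightarrow> 0"
proof (rule LIMSEQ_I)
  fix e :: real assume e: "0 < e"
  obtain u F where u: "u \<in> span (delta ` F)" "norm (\<phi> - u) < e / 2"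
    using free_space_approx[OF \<phi> half_gt_zero[OF e]] .
  have "subspace {u. (\<lambda>n. blinfun_apply u (g n)) \<longlonglongrightarrow> 0}"
    unfolding subspace_def
    by (auto simp: blinfun.bilinear_simps intro: tendsto_add_zero tendsto_scaleR[OF tendsto_const, of _ 0, simplified])
  then have "span (delta ` F) \<subseteq> {u. (\<lambda>n. blinfun_apply u (g n)) \<longlonglongrightarrow> 0}"
    using g(2) by (intro span_minimal) auto
  with u(1) have "(\<lambda>n. blinfun_apply u (g n)) \<longlonglongrightarrow> 0" by auto
  then obtain n0 where n0: "\<And>n. n \<ge> n0 \<Longrightarrow> \<bar>blinfun_apply u (g n)\<bar> < e / 2"
    using LIMSEQ_D[of _ 0 "e / 2"] e by (metis diff_zero half_gt_zero real_norm_def)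
  have "\<bar>blinfun_apply \<phi> (g n)\<bar> < e" if "n \<ge> n0" for n
  proof -
    have "\<bar>blinfun_apply (\<phi> - u) (g n)\<bar> \<le> norm (\<phi> - u) * norm (g n)"
      using norm_blinfun[of "\<phi> - u" "g n"] by simp
    also have "\<dots> \<le> norm (\<phi> - u)" using g(1)[of n] by (simp add: mult_left_le)
    finally show ?thesis using u(2) n0[OF that] by (simp add: blinfun.diff_left)
  qed
  then show "\<exists>n0. \<forall>n\<ge>n0. norm (blinfun_apply \<phi> (g n) - 0) < e" by auto
qed

text \<open>A Lipschitz function vanishing on \<open>K\<close> is uniformly small on \<open>S k\<close>, hence agrees there with
  its truncations, which tend to zero weak-star.\<close>

lemma free_space_Inter:
  fixes S :: "nat \<Rightarrow> 'a::pointed_metric_space set"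
  assumes near: "\<And>r. 0 < r \<Longrightarrow> \<exists>k. \<forall>x\<in>S k. \<exists>p\<in>K. dist x p < r"
    and \<phi>: "\<And>k. \<phi> \<in> free_space (S k)"
  shows "\<phi> \<in> free_space K"
proof (rule ccontr)
  assume "\<phi> \<notin> free_space K"
  then obtain \<Phi> :: "('a lip0 \<Rightarrow>\<^sub>L real) \<Rightarrow> real" where \<Phi>: "linear \<Phi>" "\<And>v. \<bar>\<Phi> v\<bar> \<le> norm v"
      "\<And>v. v \<in> span (delta ` K) \<Longrightarrow> \<Phi> v = 0" "\<Phi> \<phi> \<noteq> 0"
    unfolding free_space_def by (blast intro: Hahn_Banach_separation[OF subspace_span])
  have bl: "bounded_linear \<Phi>"
    using \<Phi>(1,2) by (auto simp: bounded_linear_def bounded_linear_axioms_def intro!: exI[of _ 1])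
  \<comment> \<open>Functionals on the free space are Lipschitz functions: evaluating \<Phi> at the
    points gives \<open>h\<close>, and by density the action of \<Phi> on
    \<open>free_space UNIV\<close> is evaluation at \<open>h\<close>.\<close>
  define h where "h x = \<Phi> (delta x)" for x
  have h0: "h base_point = 0" by (simp add: h_def linear_0[OF \<Phi>(1)])
  have hL: "\<bar>h x - h y\<bar> \<le> dist x y" for x y
    using \<Phi>(2)[of "delta x - delta y"] norm_delta_diff_le[of x y] by (simp add: h_def linear_diff[OF \<Phi>(1)])
  have hK: "h x = 0" if "x \<in> K" for x using \<Phi>(3) that by (simp add: h_def span_base)
  obtain f where f: "\<And>x. lip0_apply f x = h x" 
    by (rule lip0_exists[of h 1]) (use h0 hL in auto)
  have univ: "\<phi> \<in> free_space UNIV" using \<phi> free_space_mono[OF subset_UNIV] by blast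
  have "free_space UNIV \<subseteq> {w. \<Phi> w = blinfun_apply w f}"
  proof (rule free_space_subset)
    show "closed {w. \<Phi> w = blinfun_apply w f}"
      by (intro closed_Collect_eq continuous_intros bounded_linear.continuous_on[OF bl])
  qed (auto simp: subspace_def linear_add[OF \<Phi>(1)] linear_scale[OF \<Phi>(1)] linear_0[OF \<Phi>(1)]
      blinfun.bilinear_simps f h_def)
  then have nz: "blinfun_apply \<phi> f \<noteq> 0" using univ \<Phi>(4) by auto
  have "\<exists>g. (\<forall>x. lip0_apply g x = max (- (1 / Suc n)) (min (1 / Suc n) (h x))) \<and> norm g \<le> 1" for n
  proof (rule lip0_exists[of "\<lambda>x. max (- (1 / Suc n)) (min (1 / Suc n) (h x))" 1])
    have "\<bar>max (- e) (min e a) - max (- e) (min e b)\<bar> \<le> \<bar>a - b\<bar>" for a b e :: real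
      by linarith
    then show "\<bar>max (- (1 / Suc n)) (min (1 / Suc n) (h x)) - max (- (1 / Suc n)) (min (1 / Suc n) (h y))\<bar>
        \<le> 1 * dist x y" for x y
      using hL[of x y] order_trans by fastforce
  qed (auto simp: h0)
  then obtain g where g: "\<And>n x. lip0_apply (g n) x = max (- (1 / Suc n)) (min (1 / Suc n) (h x))"
    "\<And>n. norm (g n) \<le> 1" by metis
  have gle: "\<bar>lip0_apply (g n) x\<bar> \<le> inverse (Suc n)" for n x
    unfolding g(1) by (auto simp: divide_simps max_def min_def)
  have "(\<lambda>n. lip0_apply (g n) x) \<longlonglongrightarrow> 0" for x
    by (rule Lim_null_comparison[OF _ LIMSEQ_inverse_real_of_nat]) (use gle in auto)
  then have lim: "(\<lambda>n. blinfun_apply \<phi> (g n)) \<longlonglongrightarrow> 0"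
    using univ g(2) by (intro free_space_apply_tendsto_zero)
  have "blinfun_apply \<phi> f = blinfun_apply \<phi> (g n)" for n
  proof -
    obtain k where k: "\<And>x. x \<in> S k \<Longrightarrow> \<exists>p\<in>K. dist x p < 1 / Suc n" using near[of "1 / Suc n"] by auto
    show ?thesis
    proof (rule free_space_apply_cong[OF \<phi>[of k]])
      fix x assume "x \<in> S k"
      then obtain p where "p \<in> K" "dist x p < 1 / Suc n" using k by auto
      then have "\<bar>h x\<bar> < 1 / Suc n" using hL[of x p] hK[of p] by auto
      then show "lip0_apply f x = lip0_apply (g n) x" unfolding f g(1) by auto
    qed
  qed
  with lim have "(\<lambda>n::nat. blinfun_apply \<phi> f) \<longlonglongrightarrow> 0" by simp
  with nz show False by (simp add: LIMSEQ_const_iff)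
qed

text \<open>Points of \<open>S k\<close> staying \<open>r\<close> away from the intersection would
  form a totally bounded sequence, because all but finitely many of them lie in any given
  \<open>S k\<close>. A cluster point would belong to every \<open>S k\<close>, a
  contradiction.\<close>

lemma decreasing_closed_sets_near_Inter:
  fixes S :: "nat \<Rightarrow> 'a::complete_space set"
  assumes cl: "\<And>k. closed (S k)" and dec: "decseq S"
    and tb: "\<And>e. 0 < e \<Longrightarrow> \<exists>k E. finite E \<and> S k \<subseteq> (\<Union>x\<in>E. ball x e)"
  shows "compact (\<Inter>k. S k)"
    and "0 < r \<Longrightarrow> \<exists>k. \<forall>x\<in>S k. \<exists>p\<in>(\<Inter>k. S k). dist x p < r"
proof -
  let ?K = "\<Inter>k. S k"
  show "compact ?K"
    unfolding compact_eq_totally_bounded using cl tb by (fastforce simp: complete_eq_closed)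
  assume r: "0 < r"
  show "\<exists>k. \<forall>x\<in>S k. \<exists>p\<in>?K. dist x p < r"
  proof (rule ccontr)
    assume "\<not> ?thesis"
    then obtain x where x: "\<And>k. x k \<in> S k" "\<And>k p. p \<in> ?K \<Longrightarrow> r \<le> dist (x k) p"
      by (metis not_le)
    have "compact (closure (range x))"
      unfolding compact_eq_totally_bounded
    proof (intro conjI allI impI)
      fix e :: real assume e: "0 < e"
      obtain k E where kE: "finite E" "S k \<subseteq> (\<Union>x\<in>E. ball x (e / 2))" using tb[of "e / 2"] e by auto
      let ?D = "x ` {..<k} \<union> E"
      \<comment> \<open>Closed balls of half the radius, so that the covering survives passage to
        the closure; the first \<open>k\<close> terms serve as their own centres.\<close>
      have "range x \<subseteq> (\<Union>y\<in>?D. cball y (e / 2))"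
      proof clarify
        fix n show "x n \<in> (\<Union>y\<in>?D. cball y (e / 2))"
        proof (cases "n < k")
          case True then show ?thesis using e by (intro UN_I[of "x n"]) auto
        next
          case False
          then have "x n \<in> S k" using x(1)[of n] decseqD[OF dec, of k n] by auto
          then obtain z where "z \<in> E" "x n \<in> ball z (e / 2)" using kE(2) by blast
          then show ?thesis by (intro UN_I[of z]) auto
        qed
      qed
      then have "closure (range x) \<subseteq> (\<Union>y\<in>?D. cball y (e / 2))"
        using kE(1) by (intro closure_minimal closed_UN) auto
      also have "\<dots> \<subseteq> (\<Union>y\<in>?D. ball y e)" using e by (intro UN_mono cball_subset_ball_iff[THEN iffD2]) auto
      finally show "\<exists>D. finite D \<and> closure (range x) \<subseteq> (\<Union>y\<in>D. ball y e)"
        using kE(1) by (intro exI[of _ ?D]) auto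
    qed (simp add: complete_eq_closed)
    then obtain l s where s: "strict_mono s" "(x \<circ> s) \<longlonglongrightarrow> l"
      unfolding compact_eq_seq_compact_metric seq_compact_def using closure_subset[of "range x"] by blast
    have "l \<in> S k" for k
    proof (rule closed_sequentially[OF cl])
      show "(\<lambda>n. (x \<circ> s) (n + k)) \<longlonglongrightarrow> l" using s(2) by (rule LIMSEQ_ignore_initial_segment)
      show "(x \<circ> s) (n + k) \<in> S k" for n
        using x(1)[of "s (n + k)"] decseqD[OF dec, of k "s (n + k)"] seq_suble[OF s(1), of "n + k"] by auto
    qed
    then have "r \<le> dist ((x \<circ> s) n) l" for n using x(2) by auto
    moreover have "\<forall>\<^sub>F n in sequentially. dist ((x \<circ> s) n) l < r" using s(2) r by (rule tendstoD)
    ultimately show False by (auto simp: not_less[symmetric] eventually_sequentially)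
  qed
qed

subsection \<open>Multiplication by weights\<close>

text \<open>The factor \<open>1 + dist x base_point\<close> compensates for the growth of
  \<open>f\<close>, which is only bounded by \<open>norm f * dist x base_point\<close>.\<close>

definition is_weight :: "real \<Rightarrow> ('a::pointed_metric_space \<Rightarrow> real) \<Rightarrow> bool" where
  "is_weight L m \<longleftrightarrow> (\<forall>x. 0 \<le> m x \<and> m x \<le> 1) \<and>
    (\<forall>x y. (1 + dist x base_point) * \<bar>m x - m y\<bar> \<le> L * dist x y)"

definition mult_by :: "('a::pointed_metric_space \<Rightarrow> real) \<Rightarrow> 'a lip0 \<Rightarrow>\<^sub>L 'a lip0" where
  "mult_by m = Blinfun (\<lambda>f. Lip0 (\<lambda>x. m x * lip0_apply f x))"

text \<open>A product rule: the variation of \<open>m\<close> costs \<open>L\<close> by the weight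
  condition, and the variation of \<open>f\<close> costs 1 since \<open>m\<close> takes values in
  the unit interval.\<close>

lemma
  assumes m: "is_weight L m" and L: "0 \<le> L"
  shows mult_by_apply: "lip0_apply (mult_by m f) x = m x * lip0_apply f x"
    and norm_mult_by: "norm (mult_by m) \<le> 1 + L"
proof -
  define T where "T f = Lip0 (\<lambda>x. m x * lip0_apply f x)" for f
  have lip: "\<bar>m x * lip0_apply f x - m y * lip0_apply f y\<bar> \<le> ((1 + L) * norm f) * dist x y" for f x y
  proof -
    have "\<bar>lip0_apply f x\<bar> * \<bar>m x - m y\<bar> \<le> (norm f * (1 + dist x base_point)) * \<bar>m x - m y\<bar>"
      using abs_lip0_apply_le[of f x] norm_ge_zero[of f]
      by (intro mult_right_mono) (simp_all add: distrib_left del: norm_ge_zero)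
    also have "\<dots> \<le> norm f * (L * dist x y)"
      using m mult_left_mono[of _ "L * dist x y" "norm f"] by (auto simp: is_weight_def mult.assoc)
    finally have 1: "\<bar>lip0_apply f x\<bar> * \<bar>m x - m y\<bar> \<le> norm f * (L * dist x y)" .
    have "\<bar>m y\<bar> * \<bar>lip0_apply f x - lip0_apply f y\<bar> \<le> 1 * (norm f * dist x y)"
      using m lip0_lipschitz[of f x y] by (intro mult_mono) (auto simp: is_weight_def)
    moreover have "m x * lip0_apply f x - m y * lip0_apply f y =
        lip0_apply f x * (m x - m y) + m y * (lip0_apply f x - lip0_apply f y)"
      by (simp add: algebra_simps)
    then have "\<bar>m x * lip0_apply f x - m y * lip0_apply f y\<bar> \<le>
        \<bar>lip0_apply f x\<bar> * \<bar>m x - m y\<bar> + \<bar>m y\<bar> * \<bar>lip0_apply f x - lip0_apply f y\<bar>"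
      by (metis abs_mult abs_triangle_ineq)
    moreover have "((1 + L) * norm f) * dist x y = norm f * (L * dist x y) + 1 * (norm f * dist x y)"
      by (simp add: algebra_simps)
    ultimately show ?thesis using 1 by linarith
  qed
  have T: "lip0_apply (T f) x = m x * lip0_apply f x" "norm (T f) \<le> (1 + L) * norm f" for f x
  proof -
    obtain g where g: "\<And>x. lip0_apply g x = m x * lip0_apply f x" "norm g \<le> (1 + L) * norm f"
      using lip0_exists[OF _ lip[where f = f]] L by auto
    have "T f = g" unfolding T_def g(1)[symmetric] by (rule lip0_apply_inverse)
    with g show "lip0_apply (T f) x = m x * lip0_apply f x" "norm (T f) \<le> (1 + L) * norm f" by auto
  qed
  have bl: "bounded_linear T"
    by (rule bounded_linear_intro[where K = "1 + L"])
      (auto intro!: lip0_eqI simp: T(1) algebra_simps order_trans[OF T(2)])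
  then have app: "blinfun_apply (mult_by m) = T"
    unfolding mult_by_def T_def[symmetric] by (simp add: bounded_linear_Blinfun_apply)
  show "lip0_apply (mult_by m f) x = m x * lip0_apply f x" by (simp add: app T)
  show "norm (mult_by m) \<le> 1 + L" by (rule norm_blinfun_bound) (use L T in \<open>auto simp: app\<close>)
qed

text \<open>The width of the cutoff grows with the distance to the base point; this keeps the norm of
  the multiplication operator bounded independently of \<open>E\<close> even when the space is unbounded.\<close>

definition cutoff :: "real \<Rightarrow> 'a::pointed_metric_space set \<Rightarrow> 'a \<Rightarrow> real" where
  "cutoff d E x = max 0 (min 1 (2 - infdist x E / (d * (1 + dist x base_point))))"

lemma one_plus_dist_pos: "0 < 1 + dist x y"
  using zero_le_dist[of x y] by linarith

lemma cutoff_eq_1: "0 < d \<Longrightarrow> infdist x E \<le> d * (1 + dist x base_point) \<Longrightarrow> cutoff d E x = 1"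
  using mult_pos_pos[OF _ one_plus_dist_pos[of x base_point], of d] by (simp add: cutoff_def pos_divide_le_eq)

lemma cutoff_eq_0: "0 < d \<Longrightarrow> 2 * d * (1 + dist x base_point) \<le> infdist x E \<Longrightarrow> cutoff d E x = 0"
  using mult_pos_pos[OF _ one_plus_dist_pos[of x base_point], of d]
  by (simp add: cutoff_def pos_le_divide_eq max_absorb1 min_le_iff_disj mult.assoc)

text \<open>Multiplying the cutoff by its width \<open>s\<close> removes the quotient: the product
  \<open>k\<close> is Lipschitz with constant \<open>1 + 2 * d\<close>. Undoing the multiplication
  costs another \<open>d\<close>, and \<open>1 + 3 * d \<le> 4\<close>; dividing by \<open>d\<close>
  gives the constant.\<close>

lemma cutoff_is_weight:
  assumes d: "0 < d" "d \<le> 1"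
  shows "is_weight (4 / d) (cutoff d E)"
proof -
  define s where "s x = d * (1 + dist x base_point)" for x :: 'a
  define k where "k x = max 0 (min (s x) (2 * s x - infdist x E))" for x
  have s0: "0 < s x" for x unfolding s_def using mult_pos_pos[OF d(1) one_plus_dist_pos] .
  have ks: "k x = cutoff d E x * s x" for x
    using s0[of x] unfolding k_def cutoff_def s_def[symmetric]
    by (auto simp: max_def min_def field_simps)
  have sL: "\<bar>s x - s y\<bar> \<le> d * dist x y" for x y
  proof -
    have "\<bar>s x - s y\<bar> = d * \<bar>dist x base_point - dist y base_point\<bar>"
      using d(1) by (simp add: s_def abs_mult flip: right_diff_distrib)
    also have "\<bar>dist x base_point - dist y base_point\<bar> \<le> dist x y"
      using dist_triangle[of x base_point y] dist_triangle[of y base_point x]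
      by (auto simp: dist_commute)
    finally show ?thesis using d(1) by simp
  qed
  have "\<bar>k x - k y\<bar> \<le> 2 * \<bar>s x - s y\<bar> + \<bar>infdist x E - infdist y E\<bar>" for x y
    unfolding k_def by (auto simp: max_def min_def abs_if split: if_splits)
  then have kL: "\<bar>k x - k y\<bar> \<le> 2 * (d * dist x y) + dist x y" for x y
    using sL[of x y] infdist_triangle_abs[of x E y] by (smt (verit))
  have c01: "0 \<le> cutoff d E x" "cutoff d E x \<le> 1" for x by (auto simp: cutoff_def)
  have "(1 + dist x base_point) * \<bar>cutoff d E x - cutoff d E y\<bar> \<le> 4 / d * dist x y" for x y
  proof -
    have "s x * \<bar>cutoff d E x - cutoff d E y\<bar> = \<bar>s x * (cutoff d E x - cutoff d E y)\<bar>"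
      using s0[of x] by (simp add: abs_mult)
    also have "s x * (cutoff d E x - cutoff d E y) = (k x - k y) + cutoff d E y * (s y - s x)"
      by (simp add: ks algebra_simps)
    also have "\<bar>\<dots>\<bar> \<le> \<bar>k x - k y\<bar> + \<bar>s x - s y\<bar>"
      using c01[of y] mult_right_mono[of "cutoff d E y" 1 "\<bar>s x - s y\<bar>"]
        abs_triangle_ineq[of "k x - k y" "cutoff d E y * (s y - s x)"]
      by (simp add: abs_mult abs_minus_commute)
    also have "\<dots> \<le> 3 * (d * dist x y) + dist x y" using kL[of x y] sL[of x y] by linarith
    also have "\<dots> \<le> 4 * dist x y"
      using mult_right_mono[OF d(2), of "dist x y"] by simp
    finally show ?thesis using d(1) by (simp add: s_def field_simps)
  qed
  with c01 show ?thesis by (auto simp: is_weight_def)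
qed

subsection \<open>Reduction to compact sets\<close>

text \<open>In a difference of values at \<open>x\<close> and \<open>y\<close> at most two summands
  survive, one not vanishing at \<open>x\<close> and one not vanishing at \<open>y\<close>. Hence
  the factor 2, whatever the size of \<open>F\<close>.\<close>

lemma norm_sum_disjoint_supports_le:
  assumes "finite F" "\<And>n. n \<in> F \<Longrightarrow> norm (g n) \<le> C" "0 \<le> C" "\<And>n. n \<in> F \<Longrightarrow> \<bar>s n\<bar> \<le> 1"
    and disj: "\<And>i j x. i \<in> F \<Longrightarrow> j \<in> F \<Longrightarrow> lip0_apply (g i) x \<noteq> 0 \<Longrightarrow> lip0_apply (g j) x \<noteq> 0 \<Longrightarrow> i = j"
  shows "norm (\<Sum>n\<in>F. s n *\<^sub>R g n) \<le> 2 * C"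
proof (rule norm_lip0_le)
  fix x y
  define P where "P x = {n\<in>F. lip0_apply (g n) x \<noteq> 0}" for x
  have fin: "finite (P x)" for x using assms(1) by (simp add: P_def)
  have "card (P x) \<le> 1" for x
    using disj fin by (auto simp: card_le_Suc0_iff_eq P_def)
  then have card: "card (P x \<union> P y) \<le> 2"
    using card_Un_le[of "P x" "P y"] by (metis add_mono le_trans one_add_one)
  have "\<bar>lip0_apply (\<Sum>n\<in>F. s n *\<^sub>R g n) x - lip0_apply (\<Sum>n\<in>F. s n *\<^sub>R g n) y\<bar> =
      \<bar>\<Sum>n\<in>F. s n * (lip0_apply (g n) x - lip0_apply (g n) y)\<bar>"
    by (simp add: lip0_apply_sum sum_subtractf right_diff_distrib)
  also have "\<dots> \<le> (\<Sum>n\<in>F. \<bar>s n * (lip0_apply (g n) x - lip0_apply (g n) y)\<bar>)" by (rule sum_abs)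
  also have "\<dots> = (\<Sum>n\<in>P x \<union> P y. \<bar>s n * (lip0_apply (g n) x - lip0_apply (g n) y)\<bar>)"
    using assms(1) by (intro sum.mono_neutral_right) (auto simp: P_def)
  also have "\<dots> \<le> real (card (P x \<union> P y)) * (C * dist x y)"
  proof (rule sum_bounded_above)
    fix n assume "n \<in> P x \<union> P y"
    then have n: "n \<in> F" by (auto simp: P_def)
    have "\<bar>s n * (lip0_apply (g n) x - lip0_apply (g n) y)\<bar> \<le> 1 * (norm (g n) * dist x y)"
      unfolding abs_mult using assms(4)[OF n] lip0_lipschitz by (intro mult_mono) auto
    also have "\<dots> \<le> C * dist x y" using assms(2)[OF n] by (auto intro: mult_right_mono)
    finally show "\<bar>s n * (lip0_apply (g n) x - lip0_apply (g n) y)\<bar> \<le> C * dist x y" .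
  qed
  also have "\<dots> \<le> 2 * (C * dist x y)"
    using card assms(3) by (intro mult_right_mono) auto
  finally show "\<bar>lip0_apply (\<Sum>n\<in>F. s n *\<^sub>R g n) x - lip0_apply (\<Sum>n\<in>F. s n *\<^sub>R g n) y\<bar> \<le> 2 * C * dist x y"
    by simp
qed (use assms in auto)

lemma norm_blinfun_apply_le:
  "norm f \<le> a \<Longrightarrow> norm x \<le> b \<Longrightarrow> norm (blinfun_apply f x) \<le> a * b"
  by (rule order_trans[OF norm_blinfun]) (meson mult_mono norm_ge_zero order_trans)

lemma sgn_mult_self_real: "sgn (x::real) * x = \<bar>x\<bar>"
  by (simp add: sgn_if)

text \<open>A gliding hump argument: if no finite \<open>E\<close> works, cutting the resulting test functions off
  near the supports of approximants of the functionals yields disjointly supported functions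
  almost biorthogonal to a sequence in \<open>Y\<close>. Their signed sums have uniformly bounded norm, so
  they detect an isomorphic copy of the space of absolutely summable sequences.\<close>

lemma tight_of_no_ell1:
  fixes Y :: "('a::pointed_metric_space lip0 \<Rightarrow>\<^sub>L real) set" and M :: "'a lip0 \<Rightarrow>\<^sub>L 'a lip0"
  assumes Y: "subspace Y" "closed Y" and MY: "\<And>\<phi>. \<phi> \<in> Y \<Longrightarrow> \<phi> o\<^sub>L M \<in> free_space UNIV"
    and d: "0 < d" "d \<le> 1" and e: "0 < e"
    and no: "\<not> (\<exists>Z. subspace Z \<and> Z \<subseteq> Y \<and> isomorphic_ell1 Z)"
  shows "\<exists>E. finite E \<and> base_point \<in> E \<and> (\<forall>\<phi>\<in>Y. \<forall>f. norm \<phi> \<le> 1 \<longrightarrow> norm f \<le> 1 \<longrightarrow>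
    (\<forall>x. infdist x E < 2 * d * (1 + dist x base_point) \<longrightarrow> lip0_apply f x = 0) \<longrightarrow>
    \<bar>blinfun_apply \<phi> (blinfun_apply M f)\<bar> \<le> e)"
proof (rule ccontr)
  assume neg: "\<not> ?thesis"
  \<comment> \<open>\<open>C\<close> bounds the norm of the cutoff multipliers. Signed sums of the
    test functions will have norm at most \<open>2 * C\<close>, and \<kappa> makes the approximation
    error on them \<open>e / 4\<close>.\<close>
  define C where "C = 1 + 4 / d"
  define \<kappa> where "\<kappa> = e / (8 * C)"
  have C: "1 \<le> C" using d by (simp add: C_def)
  have \<kappa>: "0 < \<kappa>" "\<kappa> \<le> e / 8" "\<kappa> * (2 * C) = e / 4"
    using C e by (auto simp: \<kappa>_def field_simps)
  define near where "near E x \<longleftrightarrow> infdist x E < 2 * d * (1 + dist x base_point)" for E and x :: 'a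
  \<comment> \<open>Guarding the claim by the conditions on \<open>E\<close> makes the choice
    functions total, as the recursion below requires.\<close>
  have "\<forall>E. \<exists>\<phi> f u F. finite E \<longrightarrow> base_point \<in> E \<longrightarrow> \<phi> \<in> Y \<and> norm \<phi> \<le> 1 \<and> norm f \<le> 1 \<and>
      (\<forall>x. near E x \<longrightarrow> lip0_apply f x = 0) \<and> e < \<bar>blinfun_apply \<phi> (blinfun_apply M f)\<bar> \<and>
      finite F \<and> u \<in> span (delta ` F) \<and> norm ((\<phi> o\<^sub>L M) - u) < \<kappa>"
  proof
    fix E :: "'a set"
    show "\<exists>\<phi> f u F. finite E \<longrightarrow> base_point \<in> E \<longrightarrow> \<phi> \<in> Y \<and> norm \<phi> \<le> 1 \<and> norm f \<le> 1 \<and>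
      (\<forall>x. near E x \<longrightarrow> lip0_apply f x = 0) \<and> e < \<bar>blinfun_apply \<phi> (blinfun_apply M f)\<bar> \<and>
      finite F \<and> u \<in> span (delta ` F) \<and> norm ((\<phi> o\<^sub>L M) - u) < \<kappa>"
    proof (cases "finite E \<and> base_point \<in> E")
      case True
      then obtain \<phi> f where \<phi>: "\<phi> \<in> Y" "norm \<phi> \<le> 1" "norm f \<le> 1"
          "\<forall>x. near E x \<longrightarrow> lip0_apply f x = 0" "e < \<bar>blinfun_apply \<phi> (blinfun_apply M f)\<bar>"
        using neg unfolding near_def by (meson not_le)
      obtain u F where "finite F" "u \<in> span (delta ` F)" "norm ((\<phi> o\<^sub>L M) - u) < \<kappa>"
        using free_space_approx[OF MY[OF \<phi>(1)] \<kappa>(1)] .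
      with \<phi> show ?thesis by blast
    qed auto
  qed
  then obtain \<phi>s fs us Fs where step: "\<And>E. finite E \<Longrightarrow> base_point \<in> E \<Longrightarrow> \<phi>s E \<in> Y \<and> norm (\<phi>s E) \<le> 1 \<and>
      norm (fs E) \<le> 1 \<and> (\<forall>x. near E x \<longrightarrow> lip0_apply (fs E) x = 0) \<and>
      e < \<bar>blinfun_apply (\<phi>s E) (blinfun_apply M (fs E))\<bar> \<and>
      finite (Fs E) \<and> us E \<in> span (delta ` Fs E) \<and> norm ((\<phi>s E o\<^sub>L M) - us E) < \<kappa>"
    unfolding choice_iff by blast
  \<comment> \<open>Starting from the base point keeps every \<open>E n\<close> nonempty. The
    distance to the empty set is 0 by convention, so every point would count as near it.\<close>
  define E where "E = rec_nat {base_point} (\<lambda>_ E. E \<union> Fs E)"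
  have E0: "E 0 = {base_point}" and ES: "E (Suc n) = E n \<union> Fs (E n)" for n by (auto simp: E_def)
  have Efb: "finite (E n) \<and> base_point \<in> E n" for n
    by (induction n) (use step in \<open>auto simp: E0 ES\<close>)
  have Emono: "i \<le> j \<Longrightarrow> E i \<subseteq> E j" for i j by (rule lift_Suc_mono_le[of E]) (auto simp: ES)
  define \<phi> where "\<phi> n = \<phi>s (E n)" for n
  define f where "f n = fs (E n)" for n
  define u where "u n = us (E n)" for n
  define F where "F n = Fs (E n)" for n
  have \<phi>: "\<phi> n \<in> Y" "norm (\<phi> n) \<le> 1" and f: "norm (f n) \<le> 1" "near (E n) x \<Longrightarrow> lip0_apply (f n) x = 0"
    and big: "e < \<bar>blinfun_apply (\<phi> n) (blinfun_apply M (f n))\<bar>"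
    and u: "u n \<in> span (delta ` F n)" "norm ((\<phi> n o\<^sub>L M) - u n) < \<kappa>" for n x
    using step[of "E n"] Efb[of n] by (auto simp: \<phi>_def f_def u_def F_def)
  have uF: "u n \<in> free_space (F n)" for n
    using u(1)[of n] closure_subset unfolding free_space_def by blast
  have FE: "F i \<subseteq> E j" if "i < j" for i j using Emono[of "Suc i" j] that by (auto simp: ES F_def)
  \<comment> \<open>The cutoff lives near \<open>E (Suc n)\<close>, where all later
    \<open>f j\<close> vanish; this makes the supports disjoint. It equals 1 on \<open>F n\<close>,
    so \<open>u n\<close> does not notice the change from \<open>f n\<close> to
    \<open>g n\<close>.\<close>
  define g where "g n = blinfun_apply (mult_by (cutoff d (E (Suc n)))) (f n)" for n
  have w: "is_weight (4 / d) (cutoff d (E n))" for n by (rule cutoff_is_weight[OF d])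
  have g: "lip0_apply (g n) x = cutoff d (E (Suc n)) x * lip0_apply (f n) x" for n x
    unfolding g_def by (rule mult_by_apply[OF w]) (use d in auto)
  have gC: "norm (g n) \<le> C" for n
    using norm_blinfun_apply_le[OF norm_mult_by[OF w] f(1), of "Suc n"] d unfolding g_def C_def by simp
  have nearE: "near (E n) x" if "x \<in> E n" for n x
    using that d(1) one_plus_dist_pos[of x base_point] by (simp add: near_def)
  have near_mono: "near (E j) x" if "near (E i) x" "i \<le> j" for i j x
    using infdist_mono[OF Emono[OF that(2)], of x] Efb[of i] that(1) unfolding near_def by (metis empty_iff le_less_trans)
  have disj: "\<not> (i < j)" if "lip0_apply (g i) x \<noteq> 0" "lip0_apply (g j) x \<noteq> 0" for i j x
  proof
    assume "i < j"
    have "near (E (Suc i)) x" using that(1) cutoff_eq_0[OF d(1), of x "E (Suc i)"] unfolding near_def g by force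
    then have "near (E j) x" by (rule near_mono) (use \<open>i < j\<close> in simp)
    with f(2) that(2) show False by (auto simp: g)
  qed
  then have disj: "i = j" if "lip0_apply (g i) x \<noteq> 0" "lip0_apply (g j) x \<noteq> 0" for i j x
    using that by (meson linorder_neqE_nat)
  have ug: "blinfun_apply (u n) (g n) = blinfun_apply (u n) (f n)" for n
  proof (rule free_space_apply_cong[OF uF])
    fix x assume "x \<in> F n"
    then have "x \<in> E (Suc n)" using FE by blast
    then have "cutoff d (E (Suc n)) x = 1"
      using d(1) one_plus_dist_pos[of x base_point] by (intro cutoff_eq_1) auto
    then show "lip0_apply (g n) x = lip0_apply (f n) x" by (simp add: g)
  qed
  have low: "e - \<kappa> \<le> \<bar>blinfun_apply (u n) (g n)\<bar>" for n
  proof -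
    have "norm (blinfun_apply ((\<phi> n o\<^sub>L M) - u n) (f n)) \<le> \<kappa> * 1"
      using u(2)[of n] f(1)[of n] by (intro norm_blinfun_apply_le) auto
    with big[of n] show ?thesis by (simp add: ug blinfun.diff_left)
  qed
  have signed: "norm (\<Sum>n\<in>J. s n *\<^sub>R g n) \<le> 2 * C" if "finite J" "\<And>n. \<bar>s n\<bar> \<le> 1" for J s
    using that gC C disj by (intro norm_sum_disjoint_supports_le) auto
  define a where "a j n = \<bar>blinfun_apply (u j) (g n)\<bar>" for j n
  \<comment> \<open>Testing \<open>u j\<close> against the sum of the \<open>g n\<close> with
    matching signs gives a bound independent of \<open>j\<close> and \<open>J\<close>, as the
    disjointification requires.\<close>
  have row: "sum (a j) J \<le> (norm M + \<kappa>) * (2 * C)" if J: "finite J" for j J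
  proof -
    have "norm (u j) \<le> norm (\<phi> j o\<^sub>L M) + \<kappa>"
      using u(2)[of j] norm_triangle_ineq4[of "\<phi> j o\<^sub>L M" "(\<phi> j o\<^sub>L M) - u j"] by simp
    also have "norm (\<phi> j o\<^sub>L M) \<le> 1 * norm M"
      using norm_blinfun_compose[of "\<phi> j" M] mult_right_mono[OF \<phi>(2)[of j], of "norm M"] by simp
    finally have uj: "norm (u j) \<le> norm M + \<kappa>" by simp
    let ?G = "\<Sum>n\<in>J. sgn (blinfun_apply (u j) (g n)) *\<^sub>R g n"
    have "sum (a j) J = blinfun_apply (u j) ?G"
      by (simp add: a_def blinfun.bilinear_simps blinfun.sum_right sgn_mult_self_real)
    also have "\<dots> \<le> norm (blinfun_apply (u j) ?G)" by simp
    also have "\<dots> \<le> (norm M + \<kappa>) * (2 * C)"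
      by (rule norm_blinfun_apply_le[OF uj signed[OF J]]) (simp add: sgn_if)
    finally show ?thesis .
  qed
  obtain k where k: "(norm M + \<kappa>) * (2 * C) \<le> real k * (e / 4)"
    using ex_less_of_nat_mult[of "e / 4" "(norm M + \<kappa>) * (2 * C)"] e by (metis half_gt_zero less_imp_le zero_less_divide_iff zero_less_numeral)
  obtain N where N: "infinite N"
      "\<And>j J. j \<in> N \<Longrightarrow> finite J \<Longrightarrow> J \<subseteq> N \<Longrightarrow> j \<notin> J \<Longrightarrow> sum (a j) J \<le> e / 4"
  proof (rule Rosenthal_disjointification[of a "e / 4" UNIV k])
    show "sum (a j) J \<le> real k * (e / 4)" if "finite J" for j J
      using row[OF that, of j] k by linarith
  qed (use e in \<open>auto simp: a_def\<close>)
  define r where "r = enumerate N"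
  have r: "inj r" "r n \<in> N" for n
    using N(1) by (auto simp: r_def inj_enumerate enumerate_in_set)
  \<comment> \<open>This is \<open>e / 4\<close> divided by \<open>2 * C\<close>, the bound for the
    test function \<open>G\<close>, and by \<open>norm M + 1\<close>, which stays positive even for
    \<open>M = 0\<close>.\<close>
  define c where "c = e / (8 * C * (norm M + 1))"
  have M1: "0 < norm M + 1" using norm_ge_zero[of M] by linarith
  have c: "0 < c" using e C M1 by (simp add: c_def)
  have "c * (\<Sum>n\<in>J. \<bar>b n\<bar>) \<le> norm (\<Sum>n\<in>J. b n *\<^sub>R \<phi> (r n))" if J: "finite J" for J b
  proof -
    \<comment> \<open>The two signs make every diagonal contribution
      \<open>b m * s m * u (g)\<close> nonnegative, equal to the product of the absolute
      values.\<close>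
    define s where "s n = sgn (b n) * sgn (blinfun_apply (u (r n)) (g (r n)))" for n
    have s1: "\<bar>s n\<bar> \<le> 1" for n by (simp add: s_def sgn_if)
    define G where "G = (\<Sum>n\<in>J. s n *\<^sub>R g (r n))"
    have GC: "norm G \<le> 2 * C" unfolding G_def
      using J gC C s1 r(1) disj by (intro norm_sum_disjoint_supports_le) (auto simp: inj_eq dest: disj)
    \<comment> \<open>The diagonal term contributes at least \<open>e - \<kappa>\<close>, hence
      \<open>7 * e / 8\<close>, per unit of \<open>\<bar>b m\<bar>\<close>. Replacing \<phi> by its
      approximant and dropping the off-diagonal terms cost \<open>e / 4\<close> each, which leaves
      more than \<open>e / 4\<close>.\<close>
    have main: "e / 4 * \<bar>b m\<bar> \<le> b m * blinfun_apply (\<phi> (r m)) (blinfun_apply M G)" if m: "m \<in> J" for m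
    proof -
      have "norm (blinfun_apply ((\<phi> (r m) o\<^sub>L M) - u (r m)) G) \<le> \<kappa> * (2 * C)"
        using u(2)[of "r m"] GC by (intro norm_blinfun_apply_le) auto
      then have 1: "\<bar>blinfun_apply (\<phi> (r m)) (blinfun_apply M G) - blinfun_apply (u (r m)) G\<bar> \<le> e / 4"
        by (simp add: blinfun.diff_left \<kappa>(3))
      let ?R = "\<Sum>n\<in>J - {m}. s n * blinfun_apply (u (r m)) (g (r n))"
      have "\<bar>?R\<bar> \<le> (\<Sum>n\<in>J - {m}. a (r m) (r n))"
        using s1 by (intro order_trans[OF sum_abs] sum_mono) (simp add: a_def abs_mult mult_left_le_one_le)
      also have "\<dots> = sum (a (r m)) (r ` (J - {m}))"
        using r(1) by (subst sum.reindex) (auto intro: inj_on_subset)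
      also have "\<dots> \<le> e / 4" using r J by (intro N(2)) (auto simp: inj_eq)
      finally have 2: "\<bar>?R\<bar> \<le> e / 4" .
      have "blinfun_apply (u (r m)) G = s m * blinfun_apply (u (r m)) (g (r m)) + ?R"
        unfolding G_def by (simp add: blinfun.sum_right blinfun.scaleR_right blinfun.add_right sum.remove[OF J m])
      moreover have "b m * (s m * blinfun_apply (u (r m)) (g (r m))) =
          \<bar>b m\<bar> * \<bar>blinfun_apply (u (r m)) (g (r m))\<bar>"
        unfolding s_def by (simp add: sgn_mult_self_real[symmetric] ac_simps)
      ultimately have 3: "b m * blinfun_apply (u (r m)) G =
          \<bar>b m\<bar> * \<bar>blinfun_apply (u (r m)) (g (r m))\<bar> + b m * ?R"
        by (simp add: distrib_left)
      have "\<bar>b m\<bar> * (e - \<kappa>) \<le> \<bar>b m\<bar> * \<bar>blinfun_apply (u (r m)) (g (r m))\<bar>"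
        using low by (intro mult_left_mono) auto
      then have "\<bar>b m\<bar> * e - \<bar>b m\<bar> * \<kappa> \<le> \<bar>b m\<bar> * \<bar>blinfun_apply (u (r m)) (g (r m))\<bar>"
        by (simp only: right_diff_distrib)
      moreover have "\<bar>b m * ?R\<bar> \<le> \<bar>b m\<bar> * e / 4"
        using mult_left_mono[OF 2, of "\<bar>b m\<bar>"] by (simp add: abs_mult)
      moreover have "\<bar>b m * blinfun_apply (\<phi> (r m)) (blinfun_apply M G) - b m * blinfun_apply (u (r m)) G\<bar>
          \<le> \<bar>b m\<bar> * e / 4"
        using mult_left_mono[OF 1, of "\<bar>b m\<bar>"] by (simp add: abs_mult flip: right_diff_distrib)
      moreover have "\<bar>b m\<bar> * \<kappa> \<le> \<bar>b m\<bar> * e / 8"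
        using mult_left_mono[OF \<kappa>(2), of "\<bar>b m\<bar>"] by simp
      moreover have "0 \<le> \<bar>b m\<bar> * e" "e / 4 * \<bar>b m\<bar> = \<bar>b m\<bar> * e / 4" using e by simp_all
      ultimately show ?thesis using 3 by linarith
    qed
    let ?S = "\<Sum>n\<in>J. b n *\<^sub>R \<phi> (r n)"
    have "e / 4 * (\<Sum>n\<in>J. \<bar>b n\<bar>) \<le> blinfun_apply ?S (blinfun_apply M G)"
      using sum_mono[OF main, of J] by (simp add: blinfun.sum_left blinfun.scaleR_left sum_distrib_left)
    also have "\<dots> \<le> norm (blinfun_apply ?S (blinfun_apply M G))" by simp
    also have "\<dots> \<le> norm ?S * ((norm M + 1) * (2 * C))"
      by (intro norm_blinfun_apply_le GC) auto
    finally have "e * (\<Sum>n\<in>J. \<bar>b n\<bar>) \<le> norm ?S * (8 * C * (norm M + 1))" by (simp add: algebra_simps)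
    moreover have "0 < 8 * C * (norm M + 1)" using C M1 by simp
    ultimately show ?thesis unfolding c_def by (simp only: times_divide_eq_left pos_divide_le_eq)
  qed
  then have "\<exists>Z. subspace Z \<and> Z \<subseteq> Y \<and> isomorphic_ell1 Z"
    using ell1_basic_sequence_subspace[OF Y, of "\<lambda>n. \<phi> (r n)" c] \<phi> c by blast
  with no show False by blast
qed

lemma tight_of_no_ell1_homogeneous:
  fixes Y :: "('a::pointed_metric_space lip0 \<Rightarrow>\<^sub>L real) set" and M :: "'a lip0 \<Rightarrow>\<^sub>L 'a lip0"
  assumes Y: "subspace Y" "closed Y" and MY: "\<And>\<phi>. \<phi> \<in> Y \<Longrightarrow> \<phi> o\<^sub>L M \<in> free_space UNIV"
    and d: "0 < d" "d \<le> 1" and e: "0 < e"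
    and no: "\<not> (\<exists>Z. subspace Z \<and> Z \<subseteq> Y \<and> isomorphic_ell1 Z)"
  shows "\<exists>E. finite E \<and> base_point \<in> E \<and> (\<forall>\<phi>\<in>Y. \<forall>f.
    (\<forall>x. infdist x E < 2 * d * (1 + dist x base_point) \<longrightarrow> lip0_apply f x = 0) \<longrightarrow>
    \<bar>blinfun_apply \<phi> (blinfun_apply M f)\<bar> \<le> e * norm \<phi> * norm f)"
proof -
  obtain E where E: "finite E" "base_point \<in> E"
    and *: "\<And>\<phi> f. \<phi> \<in> Y \<Longrightarrow> norm \<phi> \<le> 1 \<Longrightarrow> norm f \<le> 1 \<Longrightarrow>
      (\<And>x. infdist x E < 2 * d * (1 + dist x base_point) \<Longrightarrow> lip0_apply f x = 0) \<Longrightarrow>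
      \<bar>blinfun_apply \<phi> (blinfun_apply M f)\<bar> \<le> e"
    using tight_of_no_ell1[OF Y MY d e no] by blast
  have "\<bar>blinfun_apply \<phi> (blinfun_apply M f)\<bar> \<le> e * norm \<phi> * norm f"
    if "\<phi> \<in> Y" "\<And>x. infdist x E < 2 * d * (1 + dist x base_point) \<Longrightarrow> lip0_apply f x = 0" for \<phi> f
  proof (cases "\<phi> = 0 \<or> f = 0")
    case True
    then show ?thesis by (auto simp: blinfun.bilinear_simps)
  next
    case False
    have "\<bar>blinfun_apply (inverse (norm \<phi>) *\<^sub>R \<phi>) (blinfun_apply M (inverse (norm f) *\<^sub>R f))\<bar> \<le> e"
      by (rule *) (use that False subspace_scale[OF Y(1)] in auto)
    then show ?thesis
      using False by (simp add: blinfun.bilinear_simps abs_mult field_simps)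
  qed
  with E show ?thesis by blast
qed

text \<open>The limit operator is controlled only on \<open>Y\<close>, whereas \<open>linear\<close>
  speaks of total functions. A Hamel basis supplies the other values, with no claim of continuity
  there.\<close>

lemma linear_extend_from_subspace:
  fixes T :: "'v::real_vector \<Rightarrow> 'w::real_vector"
  assumes Y: "subspace Y" and "\<And>x y. x \<in> Y \<Longrightarrow> y \<in> Y \<Longrightarrow> T (x + y) = T x + T y"
    "\<And>c x. x \<in> Y \<Longrightarrow> T (c *\<^sub>R x) = c *\<^sub>R T x"
  obtains G where "linear G" "\<And>x. x \<in> Y \<Longrightarrow> G x = T x"
proof -
  obtain B where B: "B \<subseteq> Y" "independent B" "Y \<subseteq> span B" using maximal_independent_subset[of Y] by blast
  obtain G where G: "linear G" "\<And>x. x \<in> B \<Longrightarrow> G x = T x"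
    using linear_independent_extend[OF B(2), of T] by blast
  have "T 0 = 0" using assms(3)[OF subspace_0[OF Y], of 0] by simp
  then have "subspace {x\<in>Y. G x = T x}"
    using Y assms(2,3) linear_add[OF G(1)] linear_scale[OF G(1)] linear_0[OF G(1)]
    by (auto simp: subspace_def)
  then have "span B \<subseteq> {x\<in>Y. G x = T x}" using B(1) G(2) by (intro span_minimal) auto
  with B(3) G(1) that show ?thesis by blast
qed

lemma infdist_finite_attained:
  assumes "finite A" "A \<noteq> {}"
  shows "\<exists>a\<in>A. infdist x A = dist x a"
proof -
  have "Min (dist x ` A) \<in> dist x ` A" using assms by (intro Min_in) auto
  moreover have "infdist x A = Min (dist x ` A)" using assms by (simp add: infdist_notempty cInf_eq_Min)
  ultimately show ?thesis by auto
qed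

text \<open>The operator is a limit of multiplications by products of cutoffs whose supports shrink to
  a compact set; each cutoff is chosen so that it barely moves the unit ball of \<open>Y\<close>.\<close>

lemma compact_reduction:
  fixes Y :: "('a::{pointed_metric_space,complete_space} lip0 \<Rightarrow>\<^sub>L real) set"
  assumes Y: "subspace Y" "closed Y" "Y \<subseteq> free_space UNIV"
    and no: "\<not> (\<exists>Z. subspace Z \<and> Z \<subseteq> Y \<and> isomorphic_ell1 Z)"
  obtains K :: "'a set" and T where "compact K" "linear T" "\<And>\<phi>. \<phi> \<in> Y \<Longrightarrow> T \<phi> \<in> free_space K"
    "\<And>\<phi>. \<phi> \<in> Y \<Longrightarrow> norm (T \<phi> - \<phi>) \<le> norm \<phi> / 2"
proof -
  \<comment> \<open>The shift by 3 gives \<open>4 * d 0 = 1/2\<close>, which will bound the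
    supports, and keeps the cutoff width \<open>2 * d k\<close> at most 1.\<close>
  define d :: "nat \<Rightarrow> real" where "d k = (1/2) ^ (k + 3)" for k
  have d: "0 < d k" "d k \<le> 1/2" for k
    using power_decreasing[of 1 "k + 3" "1/2 :: real"] by (auto simp: d_def)
  \<comment> \<open>The denominator bounds the norm of the identity minus the next multiplier. What
    remains, \<open>(1/2) ^ (k + 2)\<close>, sums to \<open>1/2\<close>.\<close>
  define e where "e k = (1/2) ^ (k + 2) / (2 + 2 / d k)" for k
  have e: "0 < e k" "e k * (2 + 2 / d k) = (1/2) ^ (k + 2)" for k
  proof -
    have *: "0 < 2 + 2 / d k" using d(1)[of k] by (simp add: add_pos_pos)
    then show "0 < e k" unfolding e_def by (intro divide_pos_pos) auto
    show "e k * (2 + 2 / d k) = (1/2) ^ (k + 2)"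
      using less_imp_neq[OF *] unfolding e_def by (metis nonzero_eq_divide_eq)
  qed
  define good where "good M k E \<longleftrightarrow> finite E \<and> base_point \<in> E \<and> (\<forall>\<phi>\<in>Y. \<forall>f.
      (\<forall>x. infdist x E < 2 * d k * (1 + dist x base_point) \<longrightarrow> lip0_apply f x = 0) \<longrightarrow>
      \<bar>blinfun_apply \<phi> (blinfun_apply M f)\<bar> \<le> e k * norm \<phi> * norm f)"
    for M :: "'a lip0 \<Rightarrow>\<^sub>L 'a lip0" and k E
  \<comment> \<open>Each finite set depends on the product formed so far. Choosing it by
    \<open>SOME\<close> lets the recursion be defined before its products are known to map
    \<open>Y\<close> into the free space, on which the existence of good sets rests.\<close>
  define Es where "Es M k = (SOME E. good M k E)" for M k
  have Es: "good M k (Es M k)" if "\<And>\<phi>. \<phi> \<in> Y \<Longrightarrow> \<phi> o\<^sub>L M \<in> free_space UNIV" for M k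
  proof -
    have "d k \<le> 1" using d(2)[of k] by simp
    then have "\<exists>E. good M k E"
      unfolding good_def using that by (intro tight_of_no_ell1_homogeneous Y d e no)
    then show ?thesis unfolding Es_def by (rule someI_ex)
  qed
  define M :: "nat \<Rightarrow> 'a lip0 \<Rightarrow>\<^sub>L 'a lip0"
    where "M = rec_nat id_blinfun (\<lambda>k M. M o\<^sub>L mult_by (cutoff (2 * d k) (Es M k)))"
  define E where "E k = Es (M k) k" for k
  \<comment> \<open>With width \<open>2 * d k\<close> the cutoff is 1 wherever tightness asks the
    test function to vanish, so \<open>f - mult_by (m k) f\<close> is admissible. It is 0 from
    \<open>4 * d k * (1 + dist x base_point)\<close> on.\<close>
  define m where "m k = cutoff (2 * d k) (E k)" for k
  have M0: "M 0 = id_blinfun" and MS: "M (Suc k) = M k o\<^sub>L mult_by (m k)" for k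
    by (auto simp: M_def E_def m_def)
  have w: "is_weight (2 / d k) (m k)" for k
    using cutoff_is_weight[of "2 * d k" "E k"] d[of k] by (simp add: m_def)
  have m: "lip0_apply (mult_by (m k) f) x = m k x * lip0_apply f x" for k f x
    by (rule mult_by_apply[OF w]) (use d(1)[of k] in simp)
  have norm_m: "norm (mult_by (m k)) \<le> 1 + 2 / d k" for k
    by (rule norm_mult_by[OF w]) (use d(1)[of k] in simp)
  define H where "H k x = (\<Prod>j<k. m j x)" for k x
  have MH: "lip0_apply (M k f) x = H k x * lip0_apply f x" for k f x
    by (induction k arbitrary: f) (auto simp: M0 MS H_def m mult_ac)
  \<comment> \<open>These sets contain the supports of the products \<open>H k\<close> and, being
    given by weak inequalities between continuous functions, are closed.\<close>
  define S where "S k = {x. \<forall>j<k. infdist x (E j) \<le> 4 * d j * (1 + dist x base_point)}" for k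
  have HS: "H k x = 0" if notin: "x \<notin> S k" for k x
  proof -
    obtain j where "j < k" "4 * d j * (1 + dist x base_point) < infdist x (E j)"
      using notin by (auto simp: S_def not_le)
    then have "m j x = 0" unfolding m_def using d(1)[of j] by (intro cutoff_eq_0) auto
    with \<open>j < k\<close> show ?thesis by (auto simp: H_def)
  qed
  have range_M: "\<phi> o\<^sub>L M k \<in> free_space (S k)" if "\<phi> \<in> free_space UNIV" for \<phi> k
  proof (rule free_space_image[OF _ _ that])
    show "bounded_linear (\<lambda>\<phi> :: 'a lip0 \<Rightarrow>\<^sub>L real. \<phi> o\<^sub>L M k)"
      by (rule bounded_bilinear.bounded_linear_left[OF bounded_bilinear_blinfun_compose])
    fix x
    have "delta x o\<^sub>L M k = H k x *\<^sub>R delta x"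
      by (rule blinfun_eqI) (simp add: MH blinfun.scaleR_left)
    then show "delta x o\<^sub>L M k \<in> free_space (S k)"
      using HS[of x k] subspace_0[OF subspace_free_space]
      by (cases "x \<in> S k") (auto intro: subspace_scale[OF subspace_free_space] delta_in_free_space)
  qed
  have MY: "\<phi> o\<^sub>L M k \<in> free_space UNIV" if "\<phi> \<in> Y" for \<phi> k
    using range_M[of \<phi> k] that Y(3) free_space_mono[OF subset_UNIV] by blast
  have E: "finite (E k)" "base_point \<in> E k"
    and tight: "\<And>\<phi> f. \<phi> \<in> Y \<Longrightarrow>
      (\<And>x. infdist x (E k) < 2 * d k * (1 + dist x base_point) \<Longrightarrow> lip0_apply f x = 0) \<Longrightarrow>
      \<bar>blinfun_apply \<phi> (blinfun_apply (M k) f)\<bar> \<le> e k * norm \<phi> * norm f" for k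
    using Es[OF MY, of k k] unfolding E_def good_def by blast+
  define D where "D k \<phi> = (\<phi> o\<^sub>L M (Suc k)) - (\<phi> o\<^sub>L M k)" for k and \<phi> :: "'a lip0 \<Rightarrow>\<^sub>L real"
  have D: "norm (D k \<phi>) \<le> norm \<phi> / 4 * (1/2) ^ k" if \<phi>: "\<phi> \<in> Y" for k \<phi>
  proof (rule norm_blinfun_bound)
    fix f
    let ?f = "f - mult_by (m k) f"
    have "norm ?f \<le> norm f + (1 + 2 / d k) * norm f"
      by (rule order_trans[OF norm_triangle_ineq4]) (intro add_left_mono norm_blinfun_apply_le norm_m order_refl)
    then have nf: "norm ?f \<le> (2 + 2 / d k) * norm f" by (simp add: algebra_simps)
    have "norm (blinfun_apply (D k \<phi>) f) = \<bar>blinfun_apply \<phi> (blinfun_apply (M k) ?f)\<bar>"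
      by (simp add: D_def MS blinfun.bilinear_simps abs_minus_commute)
    also have "\<dots> \<le> e k * norm \<phi> * norm ?f"
    proof (rule tight[OF \<phi>])
      fix x assume "infdist x (E k) < 2 * d k * (1 + dist x base_point)"
      then have "m k x = 1" unfolding m_def using d(1)[of k] by (intro cutoff_eq_1) auto
      then show "lip0_apply ?f x = 0" by (simp add: m)
    qed
    also have "\<dots> \<le> e k * norm \<phi> * ((2 + 2 / d k) * norm f)"
      using nf e(1)[of k] by (intro mult_left_mono) auto
    also have "\<dots> = (e k * (2 + 2 / d k)) * norm \<phi> * norm f" by (simp only: ac_simps)
    also have "\<dots> = norm \<phi> / 4 * (1/2) ^ k * norm f" by (simp add: e(2))
    finally show "norm (blinfun_apply (D k \<phi>) f) \<le> norm \<phi> / 4 * (1/2) ^ k * norm f" .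
  qed simp
  have geo: "(\<lambda>k. norm \<phi> / 4 * (1/2) ^ k) sums (norm \<phi> / 2)" for \<phi> :: "'a lip0 \<Rightarrow>\<^sub>L real"
    using sums_mult[OF geometric_sums[of "1/2 :: real"], of "norm \<phi> / 4"] by simp
  define T where "T \<phi> = \<phi> + (\<Sum>k. D k \<phi>)" for \<phi>
  have sD: "summable (\<lambda>k. norm (D k \<phi>))" if "\<phi> \<in> Y" for \<phi>
    by (rule summable_comparison_test'[OF sums_summable[OF geo], of 0]) (use D[OF that] in auto)
  have T_norm: "norm (T \<phi> - \<phi>) \<le> norm \<phi> / 2" if \<phi>: "\<phi> \<in> Y" for \<phi>
  proof -
    have "norm (T \<phi> - \<phi>) \<le> (\<Sum>k. norm (D k \<phi>))"
      unfolding T_def using summable_norm[OF sD[OF \<phi>]] by simp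
    also have "\<dots> \<le> (\<Sum>k. norm \<phi> / 4 * (1/2) ^ k)"
      by (rule suminf_le[OF D[OF \<phi>] sD[OF \<phi>] sums_summable[OF geo]])
    finally show ?thesis using sums_unique[OF geo, of \<phi>] by simp
  qed
  have T_lim: "(\<lambda>k. \<phi> o\<^sub>L M k) \<longlonglongrightarrow> T \<phi>" if \<phi>: "\<phi> \<in> Y" for \<phi>
  proof -
    have "(\<Sum>j<k. D j \<phi>) = (\<phi> o\<^sub>L M k) - \<phi>" for k
      unfolding D_def by (subst sum_lessThan_telescope) (auto simp: M0 intro: blinfun_eqI)
    then have "(\<lambda>k. (\<phi> o\<^sub>L M k) - \<phi>) \<longlonglongrightarrow> (\<Sum>k. D k \<phi>)"
      using summable_LIMSEQ[OF summable_norm_cancel[OF sD[OF \<phi>]]] by simp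
    from tendsto_add[OF this tendsto_const[of \<phi>]] show ?thesis by (simp add: T_def add.commute)
  qed
  obtain G where G: "linear G" "\<And>\<phi>. \<phi> \<in> Y \<Longrightarrow> G \<phi> = T \<phi>"
  proof (rule linear_extend_from_subspace[OF Y(1)])
    fix \<phi> \<psi> assume *: "\<phi> \<in> Y" "\<psi> \<in> Y"
    have "(\<phi> + \<psi>) o\<^sub>L M k = (\<phi> o\<^sub>L M k) + (\<psi> o\<^sub>L M k)" for k
      by (rule blinfun_eqI) (simp add: blinfun.add_left)
    then show "T (\<phi> + \<psi>) = T \<phi> + T \<psi>"
      using T_lim[OF subspace_add[OF Y(1) *]] tendsto_add[OF T_lim[OF *(1)] T_lim[OF *(2)]]
      by (simp add: LIMSEQ_unique)
  next
    fix c \<phi> assume *: "\<phi> \<in> Y"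
    have eq: "(c *\<^sub>R \<phi>) o\<^sub>L M k = c *\<^sub>R (\<phi> o\<^sub>L M k)" for k
      by (rule blinfun_eqI) (simp add: blinfun.scaleR_left)
    have "(\<lambda>k. (c *\<^sub>R \<phi>) o\<^sub>L M k) \<longlonglongrightarrow> c *\<^sub>R T \<phi>"
      unfolding eq by (intro tendsto_intros T_lim[OF *])
    then show "T (c *\<^sub>R \<phi>) = c *\<^sub>R T \<phi>"
      by (rule LIMSEQ_unique[OF T_lim[OF subspace_scale[OF Y(1) *]]])
  qed blast
  have S_closed: "closed (S k)" for k
    unfolding S_def by (intro closed_Collect_all closed_Collect_imp closed_Collect_le open_Collect_const continuous_intros)
  have S_dec: "decseq S" by (rule decseq_SucI) (auto simp: S_def)
  obtain R where R: "\<And>p. p \<in> E 0 \<Longrightarrow> dist p base_point \<le> R"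
    using finite_imp_bounded[OF E(1)[of 0]] unfolding bounded_any_center[of _ base_point] by (auto simp: dist_commute)
  have attain: "\<exists>p\<in>E k. infdist x (E k) = dist x p" for x k
    using infdist_finite_attained[OF E(1)] E(2) by blast
  \<comment> \<open>The widths grow with the distance to the base point, so boundedness is not
    automatic. Here \<open>4 * d 0 = 1/2\<close> bounds the distance to some \<open>p\<close> in
    \<open>E 0\<close> by half of \<open>1 + dist x base_point\<close>, and this half is
    absorbed.\<close>
  have S_bdd: "dist x base_point \<le> 1 + 2 * R" if "x \<in> S (Suc k)" for x k
  proof -
    obtain p where p: "p \<in> E 0" "infdist x (E 0) = dist x p" using attain by blast
    have "infdist x (E 0) \<le> 4 * d 0 * (1 + dist x base_point)" using that by (auto simp: S_def)
    then have "dist x p \<le> 1/2 * (1 + dist x base_point)"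
      unfolding p(2) by (simp add: d_def power3_eq_cube)
    then show ?thesis using R[OF p(1)] dist_triangle[of x base_point p] by simp
  qed
  have R0: "0 \<le> R" using R[OF E(2)] by simp
  \<comment> \<open>Once \<open>1 + dist x base_point\<close> is bounded by
    \<open>2 + 2 * R\<close>, the finite set \<open>E k\<close> is a net for
    \<open>S (Suc k)\<close> whose mesh tends to zero with \<open>d k\<close>.\<close>
  have tb: "\<exists>k F. finite F \<and> S k \<subseteq> (\<Union>x\<in>F. ball x r)" if r: "0 < r" for r
  proof -
    have "0 < r / (2 + 2 * R)" using r R0 by simp
    then obtain k where k: "(1/2) ^ k < r / (2 + 2 * R)" using real_arch_pow_inv[of _ "1/2"] by auto
    have "\<exists>p\<in>E k. dist p x < r" if x: "x \<in> S (Suc k)" for x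
    proof -
      obtain p where p: "p \<in> E k" "infdist x (E k) = dist x p" using attain by blast
      have "dist x p \<le> 4 * d k * (1 + dist x base_point)" using x p(2) by (auto simp: S_def)
      also have "\<dots> \<le> 4 * d k * (2 + 2 * R)" using S_bdd[OF x] d(1)[of k] by (intro mult_left_mono) auto
      also have "\<dots> \<le> (1/2) ^ k * (2 + 2 * R)" using R0 by (intro mult_right_mono) (simp_all add: d_def power_add power3_eq_cube)
      also have "\<dots> < r" using k R0 by (simp add: field_simps)
      finally show ?thesis using p(1) by (auto simp: dist_commute)
    qed
    then show ?thesis using E(1)[of k] by (intro exI[of _ "Suc k"] exI[of _ "E k"]) auto
  qed
  note near = decreasing_closed_sets_near_Inter[OF S_closed S_dec tb]
  have "T \<phi> \<in> free_space (\<Inter>k. S k)" if \<phi>: "\<phi> \<in> Y" for \<phi>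
  proof (rule free_space_Inter)
    show "\<exists>k. \<forall>x\<in>S k. \<exists>p\<in>(\<Inter>k. S k). dist x p < r" if "0 < r" for r
      by (rule near(2)[OF _ that])
    fix k show "T \<phi> \<in> free_space (S k)"
    proof (rule closed_sequentially[OF closed_free_space])
      show "(\<lambda>n. \<phi> o\<^sub>L M (n + k)) \<longlonglongrightarrow> T \<phi>" using T_lim[OF \<phi>] by (rule LIMSEQ_ignore_initial_segment)
      show "\<phi> o\<^sub>L M (n + k) \<in> free_space (S k)" for n
        using range_M[of \<phi> "n + k"] \<phi> Y(3) free_space_mono[OF decseqD[OF S_dec, of k "n + k"]] by auto
    qed
  qed
  then show ?thesis using that[of "\<Inter>k. S k" G] near(1) G T_norm by auto
qed

text \<open>A maximal independent subset of the image would be finite and could be pulled back to a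
  spanning set of \<open>Y\<close>. Inclusion in \<open>span B\<close> instead of equality also
  excludes that the image sits inside a larger finite-dimensional space.\<close>

lemma not_finitely_spanned_image:
  assumes Y: "subspace Y" and T: "linear T" "inj_on T Y" and inf: "\<not> (\<exists>B. finite B \<and> span B = Y)"
  shows "\<not> (\<exists>B. finite B \<and> T ` Y \<subseteq> span B)"
proof
  assume "\<exists>B. finite B \<and> T ` Y \<subseteq> span B"
  then obtain B where B: "finite B" "T ` Y \<subseteq> span B" by blast
  obtain A where A: "A \<subseteq> T ` Y" "independent A" "T ` Y \<subseteq> span A"
    using maximal_independent_subset[of "T ` Y"] by blast
  have "finite A" using independent_span_bound[OF B(1) A(2)] A(1) B(2) by auto
  then obtain A' where A': "A' \<subseteq> Y" "finite A'" "A = T ` A'" using A(1) by (meson finite_subset_image)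
  have sub: "span A' \<subseteq> Y" using A'(1) Y by (rule span_minimal)
  have "y \<in> span A'" if y: "y \<in> Y" for y
  proof -
    have "T y \<in> T ` span A'" using y A(3) A'(3) linear_span_image[OF T(1), of A'] by auto
    then obtain z where "z \<in> span A'" "T y = T z" by auto
    with y sub T(2) show ?thesis by (metis inj_onD subsetD)
  qed
  with sub A'(2) inf show False by blast
qed

theorem corollary2p12:
  assumes "infinite (UNIV :: 'a::{pointed_metric_space, complete_space} set)"
    and "\<And>K :: 'a set. compact K \<Longrightarrow> infinite K \<Longrightarrow> ell1_saturated (free_space K)"
  shows "ell1_saturated (free_space (UNIV :: 'a set))"
  unfolding ell1_saturated_def
proof (intro allI impI, elim conjE, rule ccontr)
  fix Y :: "('a lip0 \<Rightarrow>\<^sub>L real) set"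
  assume Y: "subspace Y" "closed Y" "Y \<subseteq> free_space UNIV" and inf: "\<not> (\<exists>B. finite B \<and> span B = Y)"
    and no: "\<not> (\<exists>Z. subspace Z \<and> Z \<subseteq> Y \<and> isomorphic_ell1 Z)"
  obtain K :: "'a set" and T where K: "compact K" and T: "linear T" "\<And>\<phi>. \<phi> \<in> Y \<Longrightarrow> T \<phi> \<in> free_space K"
      "\<And>\<phi>. \<phi> \<in> Y \<Longrightarrow> norm (T \<phi> - \<phi>) \<le> norm \<phi> / 2"
    using compact_reduction[OF Y no] by blast
  have low: "norm \<phi> \<le> 2 * norm (T \<phi>)" and up: "norm (T \<phi>) \<le> 2 * norm \<phi>" if "\<phi> \<in> Y" for \<phi>
    using T(3)[OF that] norm_triangle_ineq3[of "T \<phi>" \<phi>] norm_ge_zero[of \<phi>] unfolding abs_le_iff by linarith+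
  have dist_low: "dist \<phi> \<psi> \<le> 2 * dist (T \<phi>) (T \<psi>)"
    and dist_up: "dist (T \<phi>) (T \<psi>) \<le> 2 * dist \<phi> \<psi>" if "\<phi> \<in> Y" "\<psi> \<in> Y" for \<phi> \<psi>
    using low[OF subspace_diff[OF Y(1) that]] up[OF subspace_diff[OF Y(1) that]]
    by (auto simp: dist_norm linear_diff[OF T(1)])
  have T_cont: "continuous_on Y T"
    by (rule lipschitz_on_continuous_on[of 2]) (use dist_up in \<open>auto simp: lipschitz_on_def\<close>)
  have inj: "inj_on T Y"
  proof (rule inj_onI)
    fix \<phi> \<psi> assume "\<phi> \<in> Y" "\<psi> \<in> Y" "T \<phi> = T \<psi>"
    with dist_low[of \<phi> \<psi>] show "\<phi> = \<psi>" by simp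
  qed
  obtain G where G: "linear G" "\<And>\<phi>. \<phi> \<in> Y \<Longrightarrow> G (T \<phi>) = \<phi>"
    using linear_exists_left_inverse_on[OF T(1) Y(1) inj] by blast
  have G_cont: "continuous_on (T ` Y) G"
    by (rule lipschitz_on_continuous_on[of 2]) (use dist_low in \<open>auto simp: lipschitz_on_def G(2)\<close>)
  have TK: "T ` Y \<subseteq> free_space K" using T(2) by auto
  have inf': "\<not> (\<exists>B. finite B \<and> T ` Y \<subseteq> span B)" by (rule not_finitely_spanned_image[OF Y(1) T(1) inj inf])
  \<comment> \<open>The hypothesis covers infinite compact sets only. A finite \<open>K\<close>
    would have a finite-dimensional free space, with no room for the image of
    \<open>Y\<close>.\<close>
  have "infinite K"
  proof
    assume fin: "finite K"
    then have "free_space K \<subseteq> span (delta ` K)"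
      unfolding free_space_def by (simp add: closure_closed closed_span_finite)
    with fin TK inf' show False by blast
  qed
  \<comment> \<open>Because \<open>T\<close> is bounded below on \<open>Y\<close>, a convergent
    sequence of images has Cauchy preimages; these converge in \<open>Y\<close> by completeness of
    the dual space.\<close>
  have "closed (T ` Y)"
    unfolding closed_sequential_limits
  proof (intro allI impI, elim conjE)
    fix z l assume z: "\<forall>n. z n \<in> T ` Y" "z \<longlonglongrightarrow> l"
    then have "\<forall>n. \<exists>w. w \<in> Y \<and> z n = T w" by auto
    then obtain y where y: "\<And>n. y n \<in> Y" "\<And>n. z n = T (y n)" unfolding choice_iff by blast
    have "Cauchy y"
    proof (rule metric_CauchyI)
      fix e :: real assume "0 < e"
      then obtain n0 where "\<And>i j. i \<ge> n0 \<Longrightarrow> j \<ge> n0 \<Longrightarrow> dist (z i) (z j) < e / 2"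
        using metric_CauchyD[OF LIMSEQ_imp_Cauchy[OF z(2)], of "e / 2"] by auto
      then show "\<exists>n0. \<forall>i\<ge>n0. \<forall>j\<ge>n0. dist (y i) (y j) < e"
        using dist_low[OF y(1) y(1)] unfolding y(2) by (intro exI[of _ n0]) (smt (verit) field_sum_of_halves)
    qed
    then obtain y0 where y0: "y \<longlonglongrightarrow> y0" using Cauchy_convergent convergent_def by blast
    then have "y0 \<in> Y" using closed_sequentially[OF Y(2)] y(1) by blast
    moreover have "(\<lambda>n. T (y n)) \<longlonglongrightarrow> T y0"
      using continuous_on_tendsto_compose[OF T_cont y0 \<open>y0 \<in> Y\<close>] y(1) by simp
    then have "l = T y0" using z(2) LIMSEQ_unique unfolding y(2)[symmetric] by blast
    ultimately show "l \<in> T ` Y" by blast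
  qed
  moreover have "subspace (T ` Y)" by (rule linear_subspace_image[OF T(1) Y(1)])
  moreover have "\<not> (\<exists>B. finite B \<and> span B = T ` Y)" using inf' by (metis order_refl)
  ultimately have "\<exists>Z. subspace Z \<and> Z \<subseteq> T ` Y \<and> isomorphic_ell1 Z"
    using assms(2)[OF K \<open>infinite K\<close>, unfolded ell1_saturated_def, THEN spec, THEN mp, of "T ` Y"] TK
    by argo
  then obtain Z where Z: "subspace Z" "Z \<subseteq> T ` Y" "isomorphic_ell1 Z" by blast
  \<comment> \<open>The copy found in the image is carried back into \<open>Y\<close> by the inverse
    \<open>G\<close>, which is continuous on the image by the same lower bound.\<close>
  have GZ: "G ` Z \<subseteq> Y" using Z(2) G(2) by auto
  have "homeomorphism Z (G ` Z) G T"
    using Z(2) G(2) continuous_on_subset[OF G_cont Z(2)] continuous_on_subset[OF T_cont GZ]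
    by (intro homeomorphismI) auto
  then have "isomorphic_ell1 (G ` Z)" by (rule isomorphic_ell1_image[OF Z(3) G(1)])
  moreover have "subspace (G ` Z)" by (rule linear_subspace_image[OF G(1) Z(1)])
  ultimately show False using no GZ by blast
qed

end
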